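(* Let $Y=f^*+\varepsilon$ be a Gaussian vector in $\mathbb R^n$ with independent components, $Y\sim\mathcal N(f^*,\Sigma)$ for $\Sigma=\mathrm{diag}(\sigma_1^2,\dots,\sigma_n^2)$. Let $\Psi$ be a $p\times n$ feature matrix such that the $p\times p$ matrix $S=\Psi\Sigma\Psi^\top$ is non-degenerate. For a given linear presmoothing operator $\Pi:\mathbb R^n\to\mathbb R^n$, assume that $\delta_1:=\|\mathrm{Var}(\breve\varepsilon)-I_n\|_{\mathrm{op}}\le1$. Let $x>0$. Then on a set $\Omega_1(x)$ with $\mathbb P(\Omega_1(x))\ge1-3e^{-x}$ it holds for all pairs $m<m^\circ$ in $\mathcal M$ $$\Bigl|\frac{\mathsf p^\flat_{m,m^\circ}}{\mathsf p_{m,m^\circ}}-1\Bigr|\le\Delta_{\mathsf p},$$ $$\Delta_{\mathsf p}:=\|B\|_\infty^2+4x_{\mathcal M}^{1/2}\delta_\Psi^2\|B\|+4x_{\mathcal M}^{1/2}\delta_\Psi+4x_{\mathcal M}\delta_\Psi^2+\delta_\varepsilon,$$ where $\mathsf p^\flat_{m,m^\circ}=\mathbb E^\flat\|\xi^\flat_{m,m^\circ}\|^2$, $\mathsf p_{m,m^\circ}=\mathbb E\|\xi_{m,m^\circ}\|^2$, and $x_{\mathcal M}=x+2\log(|\mathcal M|)$.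
   Context: $\Psi$ has columns $\Psi_1,\dots,\Psi_n\in\mathbb R^p$; all $\sigma_i>0$. $\mathcal M$ is a finite ordered set of models (positive numbers); for $m\in\mathcal M$, $\Psi_m$ is the submatrix of $\Psi$ made of the rows (features) belonging to model $m$, and $\mathcal S_m=(\Psi_m\Psi_m^\top)^{-1}\Psi_m$, regarded as $\mathbb R^p$-valued (zero coordinates for features not in $m$). $W$ is a fixed $q\times p$ weighting matrix and $\mathcal K_{m,m^\circ}=W(\mathcal S_m-\mathcal S_{m^\circ})$ (with $\mathsf p_{m,m^\circ}>0$ so that the ratios are defined). Stochastic terms: $\xi_{m,m^\circ}=\mathcal K_{m,m^\circ}\varepsilon$. Wild bootstrap: residuals $\breve Y=Y-\Pi Y$; bootstrap weights $w^\flat\sim\mathcal N(0,I_n)$ independent of $Y$; $\xi^\flat_{m,m^\circ}=\mathcal K_{m,m^\circ}\,\mathrm{diag}(\breve Y)\,w^\flat$; $\mathbb E^\flat$ is conditional expectation given $Y$. Quantities: $\delta_\Psi=\max_i\|S^{-1/2}\Psi_i\|\sigma_i$; $B=\Sigma^{-1/2}(f^*-\Pi f^* )$ with Euclidean norm $\|B\|$ and sup-norm $\|B\|_\infty$; $\breve\varepsilon=\Sigma^{-1/2}(\varepsilon-\Pi\varepsilon)$; $\delta_\varepsilon=\max_i|\mathbb E\breve\varepsilon_i^2-1|$. *)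

theory Defs
  imports "HOL-Probability.Probability"
begin

definition diag_mat :: "real^'n \<Rightarrow> real^'n^'n" where
  "diag_mat v = (\<chi> i j. if i = j then v $ i else 0)"

definition psd_matrix :: "real^'n^'n \<Rightarrow> bool" where
  "psd_matrix A \<longleftrightarrow> transpose A = A \<and> (\<forall>v. 0 \<le> v \<bullet> (A *v v))"

text \<open>Every positive semidefinite matrix has exactly one positive semidefinite square root, so
  the description below is proper for such matrices; \<open>inv_sqrt A\<close> is \<open>A\<close> to the power \<open>-1/2\<close>.\<close>

definition matrix_sqrt :: "real^'n^'n \<Rightarrow> real^'n^'n" where
  "matrix_sqrt A = (THE R. psd_matrix R \<and> R ** R = A)"

definition inv_sqrt :: "real^'n^'n \<Rightarrow> real^'n^'n" where
  "inv_sqrt A = matrix_inv (matrix_sqrt A)"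

text \<open>Submatrices with a variable index set \<open>F\<close> are represented at full size, padded by zeros.
  For matrices supported on \<open>F \<times> F\<close>, \<open>id_on F\<close> is the unit of matrix multiplication, so
  \<open>inv_on F A\<close> is the zero-padded inverse of the submatrix of \<open>A\<close> with rows and columns in \<open>F\<close>.\<close>

definition row_submatrix :: "'p set \<Rightarrow> real^'n^'p \<Rightarrow> real^'n^'p" where
  "row_submatrix F A = (\<chi> i j. if i \<in> F then A $ i $ j else 0)"

definition id_on :: "'p set \<Rightarrow> real^'p^'p" where
  "id_on F = (\<chi> i j. if i = j \<and> i \<in> F then 1 else 0)"

definition square_submatrix :: "'p set \<Rightarrow> real^'p^'p \<Rightarrow> real^'p^'p" where
  "square_submatrix F A = (\<chi> i j. if i \<in> F \<and> j \<in> F then A $ i $ j else 0)"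

definition inv_on :: "'p set \<Rightarrow> real^'p^'p \<Rightarrow> real^'p^'p" where
  "inv_on F A = (THE G. square_submatrix F G = G \<and>
     G ** square_submatrix F A = id_on F \<and> square_submatrix F A ** G = id_on F)"

definition indep_normal_vector ::
    "'a measure \<Rightarrow> ('a \<Rightarrow> real^'n) \<Rightarrow> real^'n \<Rightarrow> real^'n \<Rightarrow> bool" where
  "indep_normal_vector M X mu sd \<longleftrightarrow>
     prob_space.indep_vars M (\<lambda>_. borel) (\<lambda>i \<omega>. X \<omega> $ i) UNIV \<and>
     (\<forall>i. distributed M lborel (\<lambda>\<omega>. X \<omega> $ i) (normal_density (mu $ i) (sd $ i)))"

definition covariance_matrix :: "'a measure \<Rightarrow> ('a \<Rightarrow> real^'n) \<Rightarrow> real^'n^'n" where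
  "covariance_matrix M X = (\<chi> i j. \<integral>\<omega>. (X \<omega> $ i - (\<integral>\<omega>'. X \<omega>' $ i \<partial>M)) *
                                       (X \<omega> $ j - (\<integral>\<omega>'. X \<omega>' $ j \<partial>M)) \<partial>M)"

definition cond_exp_given :: "'a measure \<Rightarrow> ('a \<Rightarrow> real^'n) \<Rightarrow> ('a \<Rightarrow> real) \<Rightarrow> 'a \<Rightarrow> real" where
  "cond_exp_given M Y g = real_cond_exp M (vimage_algebra (space M) Y borel) g"

text \<open>Below, \<open>sd\<close> collects the noise standard deviations, \<open>Psi\<close> is the feature matrix
  (rows are features), \<open>F\<close> and \<open>F'\<close> are the feature sets of two models, and \<open>P\<close> is the presmoothing
  operator.\<close>

definition noise_cov :: "real^'n \<Rightarrow> real^'n^'n" where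
  "noise_cov sd = diag_mat (\<chi> i. (sd $ i)\<^sup>2)"

definition design_matrix :: "real^'n \<Rightarrow> real^'n^'p \<Rightarrow> real^'p^'p" where
  "design_matrix sd Psi = Psi ** noise_cov sd ** transpose Psi"

definition model_op :: "real^'n^'p \<Rightarrow> 'p set \<Rightarrow> real^'n^'p" where
  "model_op Psi F =
     (let Psi_m = row_submatrix F Psi in inv_on F (Psi_m ** transpose Psi_m) ** Psi_m)"

definition contrast_op :: "real^'p^'q \<Rightarrow> real^'n^'p \<Rightarrow> 'p set \<Rightarrow> 'p set \<Rightarrow> real^'n^'q" where
  "contrast_op W Psi F F' = W ** (model_op Psi F - model_op Psi F')"

definition delta_Psi :: "real^'n \<Rightarrow> real^'n^'p \<Rightarrow> real" where
  "delta_Psi sd Psi =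
     (MAX i\<in>UNIV. norm (inv_sqrt (design_matrix sd Psi) *v column i Psi) * sd $ i)"

definition presmooth_residual :: "(real^'n \<Rightarrow> real^'n) \<Rightarrow> real^'n \<Rightarrow> real^'n" where
  "presmooth_residual P y = y - P y"

definition std_residual :: "real^'n \<Rightarrow> (real^'n \<Rightarrow> real^'n) \<Rightarrow> real^'n \<Rightarrow> real^'n" where
  "std_residual sd P y = inv_sqrt (noise_cov sd) *v presmooth_residual P y"

definition delta_eps ::
    "'a measure \<Rightarrow> real^'n \<Rightarrow> (real^'n \<Rightarrow> real^'n) \<Rightarrow> ('a \<Rightarrow> real^'n) \<Rightarrow> real" where
  "delta_eps M sd P eps =
     (MAX i\<in>UNIV. \<bar>(\<integral>\<omega>. (std_residual sd P (eps \<omega>) $ i)\<^sup>2 \<partial>M) - 1\<bar>)"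

definition xi ::
    "real^'p^'q \<Rightarrow> real^'n^'p \<Rightarrow> 'p set \<Rightarrow> 'p set \<Rightarrow> ('a \<Rightarrow> real^'n) \<Rightarrow> 'a \<Rightarrow> real^'q" where
  "xi W Psi F F' eps \<omega> = contrast_op W Psi F F' *v eps \<omega>"

definition xi_boot ::
    "real^'p^'q \<Rightarrow> real^'n^'p \<Rightarrow> 'p set \<Rightarrow> 'p set \<Rightarrow> (real^'n \<Rightarrow> real^'n) \<Rightarrow>
     ('a \<Rightarrow> real^'n) \<Rightarrow> ('a \<Rightarrow> real^'n) \<Rightarrow> 'a \<Rightarrow> real^'q" where
  "xi_boot W Psi F F' P Y w \<omega> =
     contrast_op W Psi F F' *v (diag_mat (presmooth_residual P (Y \<omega>)) *v w \<omega>)"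

definition p_var ::
    "'a measure \<Rightarrow> real^'p^'q \<Rightarrow> real^'n^'p \<Rightarrow> 'p set \<Rightarrow> 'p set \<Rightarrow> ('a \<Rightarrow> real^'n) \<Rightarrow> real" where
  "p_var M W Psi F F' eps = (\<integral>\<omega>. (norm (xi W Psi F F' eps \<omega>))\<^sup>2 \<partial>M)"

definition p_boot ::
    "'a measure \<Rightarrow> real^'p^'q \<Rightarrow> real^'n^'p \<Rightarrow> 'p set \<Rightarrow> 'p set \<Rightarrow> (real^'n \<Rightarrow> real^'n) \<Rightarrow>
     ('a \<Rightarrow> real^'n) \<Rightarrow> ('a \<Rightarrow> real^'n) \<Rightarrow> 'a \<Rightarrow> real" where
  "p_boot M W Psi F F' P Y w =
     cond_exp_given M Y (\<lambda>\<omega>. (norm (xi_boot W Psi F F' P Y w \<omega>))\<^sup>2)"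

text \<open>\<open>b\<close> is the standardized presmoothing bias, \<open>dPsi\<close> and \<open>deps\<close> are the values of
  \<open>delta_Psi\<close> and \<open>delta_eps\<close>; \<open>infnorm\<close> is the sup-norm.\<close>

definition Delta_p :: "real \<Rightarrow> real^'n \<Rightarrow> real \<Rightarrow> real \<Rightarrow> real" where
  "Delta_p xM b dPsi deps =
     (infnorm b)\<^sup>2 + 4 * sqrt xM * dPsi\<^sup>2 * norm b + 4 * sqrt xM * dPsi + 4 * xM * dPsi\<^sup>2 + deps"

end

theory Submission
  imports Defs
begin

text \<open>For a pair of models let \<open>K\<^sub>i\<close> be the columns of the contrast operator, \<open>s\<^sub>i\<close> the noise standard
  deviations and \<open>p\<close> the variance in the denominator. Given \<open>Y\<close>, the bootstrap variance is the sum of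
  \<open>\<parallel>K\<^sub>i\<parallel>\<^sup>2\<close> times the squared \<open>i\<close>-th residual (\<open>cond_exp_given_weighted_gaussian\<close>), and \<open>p\<close> is the sum of
  \<open>\<parallel>K\<^sub>i\<parallel>\<^sup>2 s\<^sub>i\<^sup>2\<close>. Their ratio is therefore a weighted mean of squared standardized residuals \<open>b\<^sub>i + (L g)\<^sub>i\<close>,
  with weights \<open>a\<^sub>i = \<parallel>K\<^sub>i\<parallel>\<^sup>2 s\<^sub>i\<^sup>2 / p\<close> of sum one, presmoothing bias \<open>b\<close> and a standard normal vector \<open>g\<close>.

  The contrast operator is some matrix times \<open>Psi\<close>, which forces \<open>a\<^sub>i \<le> delta_Psi\<^sup>2\<close>
  (\<open>leverage_le_delta_Psi\<close>): no observation dominates the mean. The mean thus concentrates. Its bias part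
  contributes \<open>(infnorm b)\<^sup>2\<close>, the cross term is a centered normal variable of variance at most
  \<open>8 delta_Psi\<^sup>4 \<parallel>b\<parallel>\<^sup>2\<close>, and the rest is, up to the error \<open>delta_eps\<close> in
  the residual variances, a centered Gaussian quadratic form whose eigenvalues are at most \<open>2 delta_Psi\<^sup>2\<close>
  with squares adding up to at most \<open>4 delta_Psi\<^sup>2\<close> (\<open>weighted_square_residual_deviation\<close>). Chernoff bounds
  for these terms fail with probability at most \<open>4 exp (- x\<^sub>M)\<close>, where \<open>x\<^sub>M = x + 2 ln n\<close> for \<open>n\<close> models, and the
  union over the at most \<open>n\<^sup>2 / 2\<close> pairs costs \<open>2 exp (- x)\<close> in total.

  Two classical facts carry this. Every symmetric matrix has an orthonormal eigenbasis, which gives the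
  positive semidefinite square root in \<open>inv_sqrt\<close> and diagonalizes the quadratic form. And the
  exponential moments of a Gaussian quadratic form depend on its eigenvalues only; this rests on
  linearizing the squares with an independent copy of the Gaussian vector
  (\<open>nn_mgf_quadratic_rotate\<close>).\<close>

section \<open>Spectral decomposition of symmetric matrices\<close>

lemma symmetric_matrix_inner:
  fixes A :: "real^'n^'n"
  assumes "transpose A = A"
  shows "(A *v u) \<bullet> v = u \<bullet> (A *v v)"
  by (metis assms dot_lmul_matrix vector_transpose_matrix)

text \<open>The quadratic form attains its maximum \<open>l\<close> over the unit sphere of the subspace. There the form
  \<open>l \<parallel>y\<parallel>\<^sup>2 - y \<bullet> A y\<close> is nonnegative on the subspace and vanishes at the maximizer \<open>v\<close>, so its derivative
  at \<open>v\<close> in the direction of the residual \<open>r = l v - A v\<close>, which is \<open>2 \<parallel>r\<parallel>\<^sup>2\<close>, has to vanish.\<close>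

lemma symmetric_matrix_eigenvector_in_subspace:
  fixes A :: "real^'n^'n"
  assumes sym: "transpose A = A" and V: "subspace V" "V \<noteq> {0}"
    and inv: "\<And>v. v \<in> V \<Longrightarrow> A *v v \<in> V"
  obtains v l where "v \<in> V" "norm v = 1" "A *v v = l *\<^sub>R v"
proof -
  let ?S = "V \<inter> sphere 0 1"
  obtain z where z: "z \<in> V" "z \<noteq> 0" using V subspace_0 by blast
  then have "(1 / norm z) *\<^sub>R z \<in> ?S" using V(1) by (simp add: subspace_scale)
  then have ne: "?S \<noteq> {}" by blast
  have cmp: "compact ?S"
    by (intro closed_Int_compact closed_subspace V compact_sphere)
  have "continuous_on ?S (\<lambda>v. v \<bullet> (A *v v))"
    by (intro continuous_intros linear_continuous_on) auto
  from continuous_attains_sup[OF cmp ne this]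
  obtain v where v: "v \<in> V" "norm v = 1"
    and max: "\<And>y. y \<in> V \<Longrightarrow> norm y = 1 \<Longrightarrow> y \<bullet> (A *v y) \<le> v \<bullet> (A *v v)"
    by auto
  define l where "l = v \<bullet> (A *v v)"
  define N where "N y = l * (norm y)\<^sup>2 - y \<bullet> (A *v y)" for y
  have N_nonneg: "N y \<ge> 0" if "y \<in> V" for y
  proof (cases "y = 0")
    case False
    define u where "u = (1 / norm y) *\<^sub>R y"
    have "u \<in> V" "norm u = 1" "y = norm y *\<^sub>R u"
      using False that V(1) by (auto simp: u_def subspace_scale)
    moreover have "N (norm y *\<^sub>R u) = (norm y)\<^sup>2 * (l - u \<bullet> (A *v u))"
      using \<open>norm u = 1\<close>
      by (simp add: N_def matrix_vector_mult_scaleR power2_eq_square algebra_simps)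
    ultimately show ?thesis using max[of u] by (simp add: l_def)
  qed (simp add: N_def)
  define r where "r = l *\<^sub>R v - A *v v"
  have rV: "r \<in> V" using v V inv by (simp add: r_def subspace_diff subspace_scale)
  have quad: "2 * s * (norm r)\<^sup>2 + s\<^sup>2 * N r \<ge> 0" for s
  proof -
    have "N (v + s *\<^sub>R r) = N v + 2 * s * (l * (v \<bullet> r) - r \<bullet> (A *v v)) + s\<^sup>2 * N r"
      using symmetric_matrix_inner[OF sym, of v r]
      unfolding N_def power2_norm_eq_inner
      by (simp add: matrix_vector_right_distrib matrix_vector_mult_scaleR power2_eq_square
          algebra_simps inner_commute)
    moreover have "l * (v \<bullet> r) - r \<bullet> (A *v v) = (norm r)\<^sup>2"
      unfolding power2_norm_eq_inner by (simp add: r_def algebra_simps inner_commute)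
    moreover have "N v = 0" using v by (simp add: N_def l_def)
    ultimately show ?thesis
      using N_nonneg[of "v + s *\<^sub>R r"] v rV V(1) by (simp add: subspace_add subspace_scale)
  qed
  have "r = 0"
  proof (rule ccontr)
    assume "r \<noteq> 0"
    then have n: "(norm r)\<^sup>2 > 0" by simp
    \<comment> \<open>A negative step so small that the linear term dominates; adding \<open>\<parallel>r\<parallel>\<^sup>2\<close> keeps the denominator positive when \<open>N r = 0\<close>.\<close>
    define s where "s = - (norm r)\<^sup>2 / (N r + (norm r)\<^sup>2)"
    have d: "N r + (norm r)\<^sup>2 > 0" using n N_nonneg[OF rV] by linarith
    have "2 * s * (norm r)\<^sup>2 + s\<^sup>2 * N r \<le> 2 * s * (norm r)\<^sup>2 + s\<^sup>2 * (N r + (norm r)\<^sup>2)"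
      by (simp add: algebra_simps)
    also have "\<dots> = - ((norm r)\<^sup>2)\<^sup>2 / (N r + (norm r)\<^sup>2)"
      using d by (simp add: s_def divide_simps power2_eq_square)
    also have "\<dots> < 0" using n d by (simp add: divide_neg_pos)
    finally show False using quad[of s] by linarith
  qed
  then have "A *v v = l *\<^sub>R v" by (simp add: r_def)
  with v that show ?thesis by blast
qed

text \<open>An orthonormal set of eigenvectors of maximal size spans the space: otherwise its orthogonal
  complement is a nonzero invariant subspace and contains one more unit eigenvector.\<close>

theorem symmetric_matrix_orthonormal_eigenbasis:
  fixes A :: "real^'n^'n"
  assumes sym: "transpose A = A"
  obtains e :: "'n \<Rightarrow> real^'n" and l :: "'n \<Rightarrow> real"
  where "\<And>i j. e i \<bullet> e j = (if i = j then 1 else 0)" "\<And>i. A *v e i = l i *\<^sub>R e i"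
proof -
  define ok where "ok B \<longleftrightarrow> pairwise orthogonal B \<and>
    (\<forall>b\<in>B. norm b = 1 \<and> (\<exists>l. A *v b = l *\<^sub>R b))" for B :: "(real^'n) set"
  have okD: "independent B" "finite B" "card B \<le> CARD('n)" if "ok B" for B
  proof -
    show i: "independent B"
      using that by (intro pairwise_orthogonal_independent) (auto simp: ok_def)
    show "finite B" using i independent_bound by blast
    show "card B \<le> CARD('n)" using independent_card_le[OF i] by simp
  qed
  have "ok {}" by (simp add: ok_def)
  then obtain B where B: "ok B" and Bmax: "\<And>C. ok C \<Longrightarrow> card C \<le> card B"
    using ex_has_greatest_nat[of ok "{}" card "Suc (CARD('n))"] okD(3)
    by (metis le_imp_less_Suc)
  have "span B = UNIV"
  proof (rule ccontr)
    assume "span B \<noteq> UNIV"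
    define V where "V = {v. \<forall>b\<in>B. orthogonal b v}"
    have sV: "subspace V"
      by (auto simp: V_def subspace_def orthogonal_def inner_right_distrib)
    have "dim (span B) < DIM(real^'n)"
      using \<open>span B \<noteq> UNIV\<close> dim_eq_full dim_subset_UNIV le_neq_implies_less
      by (metis dim_span)
    from orthogonal_to_subspace_exists[of B] this
    obtain y where y: "y \<noteq> 0" "\<And>x. x \<in> span B \<Longrightarrow> orthogonal y x"
      by auto
    then have "y \<in> V" using span_base orthogonal_commute unfolding V_def by blast
    with y(1) have "V \<noteq> {0}" by blast
    moreover have "A *v v \<in> V" if "v \<in> V" for v
    proof -
      have "b \<bullet> (A *v v) = 0" if b: "b \<in> B" for b
      proof -
        obtain l where "A *v b = l *\<^sub>R b" using B b unfolding ok_def by blast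
        then show ?thesis
          using \<open>v \<in> V\<close> b symmetric_matrix_inner[OF sym, of b v]
          by (auto simp: V_def orthogonal_def)
      qed
      then show ?thesis by (simp add: V_def orthogonal_def)
    qed
    ultimately obtain v l where v: "v \<in> V" "norm v = 1" "A *v v = l *\<^sub>R v"
      using symmetric_matrix_eigenvector_in_subspace[OF sym sV] by metis
    have nin: "v \<notin> B" using v by (auto simp: V_def orthogonal_def)
    have "ok (insert v B)"
      using B v by (auto simp: ok_def V_def pairwise_insert orthogonal_commute)
    from Bmax[OF this] show False using nin okD(2)[OF B] by simp
  qed
  then have "card B = CARD('n)"
    by (metis okD(1)[OF B] dim_eq_card_independent dim_span dim_UNIV DIM_cart DIM_real mult.right_neutral)
  then obtain e where e: "bij_betw e (UNIV :: 'n set) B"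
    using okD(2)[OF B] by (metis finite_code finite_same_card_bij)
  have "e i \<in> B" for i using e by (auto simp: bij_betw_def)
  then have nrm: "norm (e i) = 1" and ev: "\<exists>l. A *v e i = l *\<^sub>R e i" for i
    using B by (auto simp: ok_def)
  then obtain l where l: "\<And>i. A *v e i = l i *\<^sub>R e i" by metis
  have "e i \<bullet> e j = (if i = j then 1 else 0)" for i j
  proof (cases "i = j")
    case True
    have "e i \<bullet> e i = (norm (e i))\<^sup>2" by (simp add: power2_norm_eq_inner)
    with True nrm show ?thesis by simp
  next
    case False
    then have "e i \<noteq> e j" using e by (auto simp: bij_betw_def inj_on_def)
    then show ?thesis
      using False B \<open>\<And>i. e i \<in> B\<close> by (auto simp: ok_def pairwise_def orthogonal_def)
  qed
  with l that show ?thesis by blast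
qed

lemma orthonormal_family_expansion:
  fixes e :: "'n::finite \<Rightarrow> real^'n"
  assumes e: "\<And>i j. e i \<bullet> e j = (if i = j then 1 else 0)"
  shows "v = (\<Sum>i\<in>UNIV. (e i \<bullet> v) *\<^sub>R e i)"
proof -
  have inj: "inj e"
  proof (rule injI)
    fix i j assume "e i = e j"
    then show "i = j" using e[of i i] e[of i j] by (auto split: if_splits)
  qed
  have nz: "e i \<noteq> 0" for i using e[of i i] by auto
  have ind: "independent (range e)"
    using nz by (intro pairwise_orthogonal_independent) (auto simp: pairwise_def orthogonal_def e)
  have "dim (range e) = CARD('n)"
    using dim_eq_card_independent[OF ind] card_image[OF inj] by simp
  then have sp: "span (range e) = UNIV" using dim_eq_full[of "range e"] by simp
  define r where "r = v - (\<Sum>i\<in>UNIV. (e i \<bullet> v) *\<^sub>R e i)"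
  have "r \<bullet> e j = 0" for j
    by (simp add: r_def inner_diff_left inner_sum_left e if_distrib[of "(*) _"]
        inner_commute[of v] cong: if_cong)
  then have "orthogonal r b" if "b \<in> range e" for b using that by (auto simp: orthogonal_def)
  then have "orthogonal r r" using orthogonal_to_span[of "r" "range e" r] sp
    by (metis UNIV_I orthogonal_commute)
  then show ?thesis by (simp add: r_def orthogonal_def)
qed

lemma orthonormal_family_parseval:
  fixes e :: "'n::finite \<Rightarrow> real^'n"
  assumes e: "\<And>i j. e i \<bullet> e j = (if i = j then 1 else 0)"
  shows "(\<Sum>i\<in>UNIV. (e i \<bullet> v) * (e i \<bullet> w)) = v \<bullet> w"
proof -
  have "v \<bullet> w = (\<Sum>i\<in>UNIV. (e i \<bullet> v) *\<^sub>R e i) \<bullet> w"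
    using orthonormal_family_expansion[OF e, of v] by simp
  then show ?thesis by (simp add: inner_sum_left)
qed

section \<open>Square roots and the leverage bound\<close>

text \<open>This determines a positive semidefinite root on every eigenvector of its square. Since
  \<open>T\<^sup>2 e = l e\<close>, the vector \<open>u = T e - sqrt l e\<close> satisfies \<open>T u = - sqrt l u\<close>, and positivity of \<open>T\<close>
  leaves no room for \<open>u \<noteq> 0\<close> when \<open>l > 0\<close>. For \<open>l = 0\<close>, symmetry gives \<open>\<parallel>T e\<parallel>\<^sup>2 = e \<bullet> T\<^sup>2 e = 0\<close>.\<close>

lemma psd_root_on_eigenvector:
  fixes T :: "real^'n^'n"
  assumes T: "psd_matrix T" and e: "(T ** T) *v e = l *\<^sub>R e" and l: "l \<ge> 0"
  shows "T *v e = sqrt l *\<^sub>R e"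
proof -
  have sym: "transpose T = T" and pos: "\<And>v. 0 \<le> v \<bullet> (T *v v)"
    using T by (auto simp: psd_matrix_def)
  have TT: "T *v (T *v e) = l *\<^sub>R e" using e by (simp add: matrix_vector_mul_assoc)
  define u where "u = T *v e - sqrt l *\<^sub>R e"
  have Tu: "T *v u = - sqrt l *\<^sub>R u"
    using l by (simp add: u_def matrix_vector_mult_diff_distrib TT matrix_vector_mult_scaleR algebra_simps)
  have "u = 0"
  proof (cases "l = 0")
    case True
    have "(T *v e) \<bullet> (T *v e) = e \<bullet> (T *v (T *v e))" by (rule symmetric_matrix_inner[OF sym])
    then show ?thesis using True TT by (simp add: u_def)
  next
    case False
    then have "sqrt l > 0" using l by simp
    moreover have "0 \<le> - (sqrt l * (u \<bullet> u))" using pos[of u] by (simp add: Tu)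
    ultimately have "u \<bullet> u \<le> 0" by (simp add: mult_le_0_iff)
    then show ?thesis by (metis inner_eq_zero_iff inner_ge_zero order_antisym)
  qed
  then show ?thesis by (simp add: u_def)
qed

text \<open>Existence takes the root of each eigenvalue in an orthonormal eigenbasis. For uniqueness, a root
  is prescribed on that basis by the preceding lemma.\<close>

theorem psd_matrix_sqrt_ex1:
  fixes A :: "real^'n^'n"
  assumes A: "psd_matrix A"
  shows "\<exists>!R. psd_matrix R \<and> R ** R = A"
proof -
  have sym: "transpose A = A" and pos: "\<And>v. 0 \<le> v \<bullet> (A *v v)"
    using A by (auto simp: psd_matrix_def)
  obtain e :: "'n \<Rightarrow> real^'n" and l where e: "\<And>i j. e i \<bullet> e j = (if i = j then 1 else 0)"
    and l: "\<And>i. A *v e i = l i *\<^sub>R e i"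
    using symmetric_matrix_orthonormal_eigenbasis[OF sym] by metis
  have l0: "l i \<ge> 0" for i using pos[of "e i"] by (simp add: l e)
  define R :: "real^'n^'n" where "R = (\<chi> a b. \<Sum>k\<in>UNIV. sqrt (l k) * e k $ a * e k $ b)"
  have Rv: "R *v v = (\<Sum>k\<in>UNIV. (sqrt (l k) * (e k \<bullet> v)) *\<^sub>R e k)" for v
  proof -
    have "(R *v v) $ a = (\<Sum>k\<in>UNIV. (sqrt (l k) * (e k \<bullet> v)) *\<^sub>R e k) $ a" for a
    proof -
      have "(R *v v) $ a = (\<Sum>b\<in>UNIV. \<Sum>k\<in>UNIV. sqrt (l k) * e k $ a * e k $ b * v $ b)"
        by (simp add: R_def matrix_vector_mult_def sum_distrib_right)
      also have "\<dots> = (\<Sum>k\<in>UNIV. \<Sum>b\<in>UNIV. sqrt (l k) * e k $ a * e k $ b * v $ b)"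
        by (rule sum.swap)
      finally show ?thesis
        by (simp add: inner_vec_def sum_distrib_left sum_distrib_right mult_ac)
    qed
    then show ?thesis by (simp add: vec_eq_iff)
  qed
  have Re: "R *v e i = sqrt (l i) *\<^sub>R e i" for i
  proof -
    have "R *v e i = (\<Sum>k\<in>UNIV. if k = i then sqrt (l i) *\<^sub>R e i else 0)"
      unfolding Rv by (rule sum.cong) (auto simp: e)
    then show ?thesis by simp
  qed
  have ext: "X = Z" if "\<And>i. X *v e i = Z *v e i" for X Z :: "real^'n^'n"
  proof -
    have "X *v v = Z *v v" for v
    proof -
      have "X *v v = (\<Sum>i\<in>UNIV. (e i \<bullet> v) *\<^sub>R (X *v e i))" for X :: "real^'n^'n"
        by (subst orthonormal_family_expansion[OF e, of v])
          (simp add: linear_sum[OF matrix_vector_mul_linear] matrix_vector_mult_scaleR)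
      then show ?thesis by (simp add: that)
    qed
    then show ?thesis by (simp add: matrix_eq)
  qed
  have "psd_matrix R"
    unfolding psd_matrix_def
  proof
    show "transpose R = R" by (simp add: R_def transpose_def mult_ac)
    show "\<forall>v. 0 \<le> v \<bullet> (R *v v)"
      using l0 by (auto simp: Rv inner_sum_right inner_commute mult.assoc mult_nonneg_nonneg
          intro!: sum_nonneg)
  qed
  moreover have "R ** R = A"
    by (rule ext) (simp add: matrix_vector_mul_assoc[symmetric] Re matrix_vector_mult_scaleR l l0)
  moreover have "T = R" if "psd_matrix T" "T ** T = A" for T
    by (rule ext) (use psd_root_on_eigenvector[OF that(1)] that(2) l l0 Re in simp)
  ultimately show ?thesis by blast
qed

lemma
  assumes "psd_matrix A"
  shows psd_matrix_matrix_sqrt: "psd_matrix (matrix_sqrt A)"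
    and matrix_sqrt_square: "matrix_sqrt A ** matrix_sqrt A = A"
  using theI'[OF psd_matrix_sqrt_ex1[OF assms]] by (auto simp: matrix_sqrt_def)

lemma matrix_sqrt_unique:
  assumes "psd_matrix R" "R ** R = A"
  shows "matrix_sqrt A = R"
proof -
  have "psd_matrix A"
    unfolding psd_matrix_def
  proof
    show "transpose A = A" using assms by (auto simp: psd_matrix_def matrix_transpose_mul)
    have "v \<bullet> (A *v v) = (R *v v) \<bullet> (R *v v)" for v
      using symmetric_matrix_inner[of R v "R *v v"] assms
      by (auto simp: psd_matrix_def matrix_vector_mul_assoc)
    then show "\<forall>v. 0 \<le> v \<bullet> (A *v v)" by simp
  qed
  then show ?thesis
    using psd_matrix_sqrt_ex1 assms unfolding matrix_sqrt_def by (blast intro: the1_equality)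
qed

lemma matrix_inv_eqI:
  fixes A :: "real^'n^'n"
  assumes "A ** B = mat 1"
  shows "matrix_inv A = B"
proof -
  have BA: "B ** A = mat 1" using assms matrix_left_right_inverse by blast
  then have "\<exists>B. A ** B = mat 1 \<and> B ** A = mat 1" using assms by blast
  then have "A ** matrix_inv A = mat 1" unfolding matrix_inv_def by (rule someI2_ex) blast
  then show ?thesis by (metis BA matrix_mul_assoc matrix_mul_lid matrix_mul_rid)
qed

lemma diag_mat_mult_vec: "(diag_mat a *v v) $ i = a $ i * v $ i"
  by (simp add: diag_mat_def matrix_vector_mult_def if_distrib[of "\<lambda>x. x * _"] cong: if_cong)

lemma inv_sqrt_noise_cov:
  fixes sd :: "real^'n"
  assumes "\<And>i. sd $ i > 0"
  shows "inv_sqrt (noise_cov sd) = diag_mat (\<chi> i. 1 / sd $ i)"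
proof -
  have mul: "diag_mat a ** diag_mat b = diag_mat (\<chi> i. a $ i * b $ i)" for a b :: "real^'n"
    by (simp add: matrix_eq vec_eq_iff diag_mat_mult_vec matrix_vector_mul_assoc[symmetric] mult.assoc)
  have "psd_matrix (diag_mat sd)"
    unfolding psd_matrix_def
  proof
    show "transpose (diag_mat sd) = diag_mat sd"
      by (simp add: diag_mat_def transpose_def vec_eq_iff)
    show "\<forall>v. 0 \<le> v \<bullet> (diag_mat sd *v v)"
    proof
      fix v :: "real^'n"
      have "v \<bullet> (diag_mat sd *v v) = (\<Sum>i\<in>UNIV. sd $ i * (v $ i)\<^sup>2)"
        by (simp add: inner_vec_def diag_mat_mult_vec power2_eq_square mult_ac)
      then show "0 \<le> v \<bullet> (diag_mat sd *v v)"
        using assms by (simp add: sum_nonneg less_imp_le)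
    qed
  qed
  then have "matrix_sqrt (noise_cov sd) = diag_mat sd"
    by (rule matrix_sqrt_unique) (simp add: mul noise_cov_def power2_eq_square)
  moreover have "diag_mat sd ** diag_mat (\<chi> i. 1 / sd $ i) = mat 1"
    unfolding mul using assms by (simp add: diag_mat_def mat_def vec_eq_iff less_imp_neq[symmetric])
  ultimately show ?thesis by (simp add: inv_sqrt_def matrix_inv_eqI)
qed

lemma std_residual_component:
  assumes "\<And>i. sd $ i > 0"
  shows "std_residual sd P y $ i = (y - P y) $ i / sd $ i"
  using assms by (simp add: std_residual_def presmooth_residual_def inv_sqrt_noise_cov diag_mat_mult_vec)

lemma design_matrix_quadratic_form:
  fixes Psi :: "real^'n^'p"
  shows "a \<bullet> (design_matrix sd Psi *v a) = (\<Sum>i\<in>UNIV. (sd $ i)\<^sup>2 * (a \<bullet> column i Psi)\<^sup>2)"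
proof -
  have t: "(transpose Psi *v a) $ i = a \<bullet> column i Psi" for i
    by (simp add: matrix_vector_mult_def transpose_def column_def inner_vec_def mult.commute)
  have "a \<bullet> (design_matrix sd Psi *v a)
      = a \<bullet> (Psi *v (noise_cov sd *v (transpose Psi *v a)))"
    by (simp add: design_matrix_def matrix_vector_mul_assoc matrix_mul_assoc
        del: transpose_matrix_vector)
  also have "\<dots> = (transpose Psi *v a) \<bullet> (noise_cov sd *v (transpose Psi *v a))"
    by (metis dot_lmul_matrix transpose_matrix_vector)
  finally show ?thesis
    unfolding inner_vec_def[of "transpose Psi *v a"] t noise_cov_def diag_mat_mult_vec
    by (simp add: power2_eq_square mult_ac)
qed

lemma psd_matrix_design_matrix: "psd_matrix (design_matrix sd Psi)"
  unfolding psd_matrix_def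
proof
  have "transpose (noise_cov sd) = noise_cov sd"
    by (simp add: noise_cov_def diag_mat_def transpose_def vec_eq_iff)
  then show "transpose (design_matrix sd Psi) = design_matrix sd Psi"
    by (simp add: design_matrix_def matrix_transpose_mul matrix_mul_assoc)
  show "\<forall>v. 0 \<le> v \<bullet> (design_matrix sd Psi *v v)"
    unfolding design_matrix_quadratic_form by (auto intro!: sum_nonneg)
qed

lemma column_matrix_mult: "column i (A ** B) = A *v column i B" for A :: "real^'p^'q"
  by (simp add: column_def matrix_matrix_mult_def matrix_vector_mult_def vec_eq_iff)

text \<open>This is where \<open>delta_Psi\<close> enters: no single observation carries more than the fraction
  \<open>delta_Psi\<^sup>2\<close> of the total variance of \<open>A Psi\<close> applied to the noise. Write \<open>R\<close> for the square root of the design matrix \<open>S\<close>. The rows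
  \<open>a\<close> of \<open>A\<close> satisfy \<open>a \<bullet> Psi_i = (R a) \<bullet> (S^(-1/2) Psi_i)\<close>, to which Cauchy-Schwarz applies, and the
  squared norms \<open>\<parallel>R a\<parallel>\<^sup>2 = a \<bullet> S a\<close> add up to the sum on the right.\<close>

lemma leverage_le_delta_Psi:
  fixes Psi :: "real^'n^'p" and A :: "real^'p^'q"
  assumes S: "invertible (design_matrix sd Psi)" and sd: "\<And>i. sd $ i > 0"
  shows "(norm (column i (A ** Psi)))\<^sup>2 * (sd $ i)\<^sup>2
    \<le> (delta_Psi sd Psi)\<^sup>2 * (\<Sum>j\<in>UNIV. (norm (column j (A ** Psi)))\<^sup>2 * (sd $ j)\<^sup>2)"
proof -
  define R where "R = matrix_sqrt (design_matrix sd Psi)"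
  have psdR: "psd_matrix R" and RR: "R ** R = design_matrix sd Psi"
    using psd_matrix_design_matrix psd_matrix_matrix_sqrt matrix_sqrt_square R_def by metis+
  then have symR: "transpose R = R" by (simp add: psd_matrix_def)
  obtain T where "design_matrix sd Psi ** T = mat 1" using S invertible_def by blast
  then have "R ** (R ** T) = mat 1" by (simp add: RR matrix_mul_assoc)
  then have RI: "R ** inv_sqrt (design_matrix sd Psi) = mat 1"
    unfolding inv_sqrt_def R_def[symmetric] using matrix_inv_eqI by metis
  define z where "z = inv_sqrt (design_matrix sd Psi) *v column i Psi"
  have Rz: "R *v z = column i Psi" by (simp add: z_def matrix_vector_mul_assoc RI)
  have zd: "norm z * sd $ i \<le> delta_Psi sd Psi"
    unfolding delta_Psi_def z_def by (rule Max_ge) auto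
  note comp = matrix_vector_mul_component[of A]
  have nsq: "(norm (column j (A ** Psi)))\<^sup>2 = (\<Sum>k\<in>UNIV. (A $ k \<bullet> column j Psi)\<^sup>2)" for j
    unfolding column_matrix_mult
    unfolding power2_norm_eq_inner inner_vec_def[of "A *v column j Psi"] comp
    by (simp add: power2_eq_square)
  have rw: "(norm (R *v a))\<^sup>2 = (\<Sum>j\<in>UNIV. (sd $ j)\<^sup>2 * (a \<bullet> column j Psi)\<^sup>2)" for a
    using symmetric_matrix_inner[OF symR, of a "R *v a"] design_matrix_quadratic_form[of a sd Psi]
    by (simp add: power2_norm_eq_inner matrix_vector_mul_assoc RR)
  have "(A $ k \<bullet> column i Psi)\<^sup>2 \<le> (norm (R *v (A $ k)))\<^sup>2 * (norm z)\<^sup>2" for k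
  proof -
    have "A $ k \<bullet> column i Psi = (R *v (A $ k)) \<bullet> z"
      unfolding Rz[symmetric] using symmetric_matrix_inner[OF symR] by metis
    then have "\<bar>A $ k \<bullet> column i Psi\<bar> \<le> norm (R *v (A $ k)) * norm z"
      by (simp add: Cauchy_Schwarz_ineq2)
    from power_mono[OF this, of 2] show ?thesis by (simp add: power_mult_distrib)
  qed
  then have "(norm (column i (A ** Psi)))\<^sup>2 \<le> (\<Sum>k\<in>UNIV. (norm (R *v (A $ k)))\<^sup>2 * (norm z)\<^sup>2)"
    unfolding nsq by (intro sum_mono)
  also have "\<dots> = (norm z)\<^sup>2 * (\<Sum>k\<in>UNIV. \<Sum>j\<in>UNIV. (sd $ j)\<^sup>2 * (A $ k \<bullet> column j Psi)\<^sup>2)"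
    by (simp add: rw sum_distrib_left mult.commute)
  also have "(\<Sum>k\<in>UNIV. \<Sum>j\<in>UNIV. (sd $ j)\<^sup>2 * (A $ k \<bullet> column j Psi)\<^sup>2)
      = (\<Sum>j\<in>UNIV. (norm (column j (A ** Psi)))\<^sup>2 * (sd $ j)\<^sup>2)"
    by (subst sum.swap) (simp add: nsq sum_distrib_left mult.commute)
  finally have "(norm (column i (A ** Psi)))\<^sup>2 * (sd $ i)\<^sup>2 \<le>
      (norm z)\<^sup>2 * (\<Sum>j\<in>UNIV. (norm (column j (A ** Psi)))\<^sup>2 * (sd $ j)\<^sup>2) * (sd $ i)\<^sup>2"
    by (rule mult_right_mono) simp
  also have "\<dots> = (norm z * sd $ i)\<^sup>2 * (\<Sum>j\<in>UNIV. (norm (column j (A ** Psi)))\<^sup>2 * (sd $ j)\<^sup>2)"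
    by (simp add: power_mult_distrib)
  also have "\<dots> \<le> (delta_Psi sd Psi)\<^sup>2 * (\<Sum>j\<in>UNIV. (norm (column j (A ** Psi)))\<^sup>2 * (sd $ j)\<^sup>2)"
    using zd less_imp_le[OF sd] by (intro mult_right_mono power_mono sum_nonneg) auto
  finally show ?thesis .
qed

lemma row_submatrix_eq_id_on_mult: "row_submatrix F A = id_on F ** A"
  by (auto simp: row_submatrix_def id_on_def matrix_matrix_mult_def vec_eq_iff
      if_distrib[of "\<lambda>x. x * _"] cong: if_cong)

text \<open>Restricting the feature matrix to the rows of a model is a multiplication by \<open>id_on\<close> from the left, so
  that every model operator, whatever the matrix in front, is a matrix times the full \<open>Psi\<close>.\<close>

lemma contrast_op_factors_through_Psi:
  obtains A where "contrast_op W Psi F F' = A ** Psi"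
proof -
  define G where "G F = inv_on F (row_submatrix F Psi ** transpose (row_submatrix F Psi)) ** id_on F" for F
  have "model_op Psi F = G F ** Psi" for F
    by (simp add: model_op_def Let_def G_def matrix_mul_assoc[symmetric] row_submatrix_eq_id_on_mult)
  then have "contrast_op W Psi F F' = (W ** (G F - G F')) ** Psi"
    by (simp add: contrast_op_def matrix_mul_assoc[symmetric])
      (simp add: matrix_matrix_mult_def vec_eq_iff left_diff_distrib sum_subtractf)
  then show ?thesis using that by blast
qed

section \<open>Exponential moments of standard normal vectors\<close>

lemma (in prob_space) indep_normal_vector_standardize:
  fixes X :: "'a \<Rightarrow> real^'n"
  assumes X: "indep_normal_vector M X mu sd" and sd: "\<And>i. sd $ i > 0"
  shows "indep_normal_vector M (\<lambda>\<omega>. \<chi> i. (X \<omega> $ i - mu $ i) / sd $ i) 0 (\<chi> i. 1)"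
proof -
  have ind: "indep_vars (\<lambda>_. borel) (\<lambda>i \<omega>. X \<omega> $ i) UNIV"
    using X by (simp add: indep_normal_vector_def)
  have "indep_vars (\<lambda>_. borel) (\<lambda>i \<omega>. (X \<omega> $ i - mu $ i) / sd $ i) UNIV"
    by (rule indep_vars_compose2[OF ind, where Y="\<lambda>i y. (y - mu $ i) / sd $ i"]) simp
  moreover have "distributed M lborel (\<lambda>\<omega>. (X \<omega> $ i - mu $ i) / sd $ i) std_normal_density" for i
    using X normal_standard_normal_convert[OF sd] by (simp add: indep_normal_vector_def)
  ultimately show ?thesis by (simp add: indep_normal_vector_def)
qed

lemma measurable_vec_nth [measurable]: "(\<lambda>x :: real^'n. x $ i) \<in> borel_measurable borel"
  by (intro borel_measurable_continuous_onI continuous_intros)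

lemma borel_measurable_vecI:
  fixes X :: "'a \<Rightarrow> real^'n"
  assumes "\<And>i. (\<lambda>\<omega>. X \<omega> $ i) \<in> borel_measurable M"
  shows "X \<in> borel_measurable M"
  using assms by (subst borel_measurable_euclidean_space) (auto simp: Basis_vec_def inner_axis)

lemma indep_normal_vector_measurable:
  fixes X :: "'a \<Rightarrow> real^'n"
  assumes "indep_normal_vector M X mu sd"
  shows "X \<in> borel_measurable M"
proof -
  have "(\<lambda>\<omega>. X \<omega> $ i) \<in> borel_measurable M" for i
    using assms distributed_measurable by (fastforce simp: indep_normal_vector_def)
  then show ?thesis by (rule borel_measurable_vecI)
qed

lemma nn_integral_normal_density:
  assumes "0 < \<sigma>"
  shows "(\<integral>\<^sup>+x. ennreal (normal_density \<mu> \<sigma> x) \<partial>lborel) = 1"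
  using assms by (subst nn_integral_eq_integral) auto

lemma std_normal_nn_mgf:
  assumes X: "distributed M lborel X std_normal_density"
  shows "(\<integral>\<^sup>+\<omega>. ennreal (exp (u * X \<omega>)) \<partial>M) = ennreal (exp (u\<^sup>2 / 2))"
proof -
  have *: "std_normal_density x * exp (u * x) = exp (u\<^sup>2 / 2) * normal_density u 1 x" for x
    by (simp add: normal_density_def exp_add[symmetric] power2_eq_square field_simps)
  have "(\<integral>\<^sup>+\<omega>. ennreal (exp (u * X \<omega>)) \<partial>M)
      = (\<integral>\<^sup>+x. ennreal (std_normal_density x) * ennreal (exp (u * x)) \<partial>lborel)"
    by (rule distributed_nn_integral[OF X, symmetric]) simp
  also have "\<dots> = (\<integral>\<^sup>+x. ennreal (exp (u\<^sup>2 / 2)) * ennreal (normal_density u 1 x) \<partial>lborel)"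
    by (simp add: ennreal_mult[symmetric] *)
  also have "\<dots> = ennreal (exp (u\<^sup>2 / 2))"
    by (simp add: nn_integral_cmult nn_integral_normal_density)
  finally show ?thesis .
qed

lemma std_normal_square_nn_mgf:
  assumes X: "distributed M lborel X std_normal_density" and s: "2 * s < 1"
  shows "(\<integral>\<^sup>+\<omega>. ennreal (exp (s * (X \<omega>)\<^sup>2)) \<partial>M) = ennreal (1 / sqrt (1 - 2 * s))"
proof -
  define \<tau> where "\<tau> = 1 / sqrt (1 - 2 * s)"
  have \<tau>: "\<tau> > 0" "\<tau>\<^sup>2 = 1 / (1 - 2 * s)" using s by (auto simp: \<tau>_def power_divide)
  have *: "std_normal_density x * exp (s * x\<^sup>2) = \<tau> * normal_density 0 \<tau> x" for x
  proof -
    have "- x\<^sup>2 / 2 + s * x\<^sup>2 = - x\<^sup>2 / (2 * \<tau>\<^sup>2)"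
      using s unfolding \<tau>(2) by (simp add: field_simps)
    then show ?thesis
      using \<tau>(1) by (simp add: normal_density_def exp_add[symmetric] real_sqrt_mult)
  qed
  have "(\<integral>\<^sup>+\<omega>. ennreal (exp (s * (X \<omega>)\<^sup>2)) \<partial>M)
      = (\<integral>\<^sup>+x. ennreal (std_normal_density x) * ennreal (exp (s * x\<^sup>2)) \<partial>lborel)"
    by (rule distributed_nn_integral[OF X, symmetric]) simp
  also have "\<dots> = (\<integral>\<^sup>+x. ennreal \<tau> * ennreal (normal_density 0 \<tau> x) \<partial>lborel)"
    using \<tau> by (simp add: ennreal_mult[symmetric] *)
  also have "\<dots> = ennreal \<tau>"
    using \<tau> by (simp add: nn_integral_cmult nn_integral_normal_density)
  finally show ?thesis by (simp add: \<tau>_def)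
qed

lemma std_normal_expectation_iexp:
  assumes X: "distributed M lborel X std_normal_density"
  shows "(CLINT \<omega>|M. iexp (u * X \<omega>)) = complex_of_real (exp (- u\<^sup>2 / 2))"
proof -
  have "distr M lborel X = std_normal_distribution"
    using X by (simp add: distributed_def)
  moreover have "(CLINT \<omega>|M. iexp (u * X \<omega>)) = (CLINT x|distr M lborel X. iexp (u * x))"
    using distributed_measurable[OF X] by (subst integral_distr) auto
  ultimately show ?thesis
    using fun_cong[OF char_std_normal_distribution, of u] by (simp add: char_def)
qed

lemma norm_vec_square: "(norm v)\<^sup>2 = (\<Sum>i\<in>UNIV. (v $ i)\<^sup>2)" for v :: "real^'n"
  unfolding power2_norm_eq_inner inner_vec_def by (simp add: power2_eq_square)

lemma norm_orthonormal_sum_square: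
  fixes e :: "'n::finite \<Rightarrow> real^'n"
  assumes e: "\<And>i j. e i \<bullet> e j = (if i = j then 1 else 0)"
  shows "(norm (\<Sum>k\<in>UNIV. a k *\<^sub>R e k))\<^sup>2 = (\<Sum>k\<in>UNIV. (a k)\<^sup>2)"
  unfolding power2_norm_eq_inner inner_sum_left inner_sum_right
  by (simp add: e power2_eq_square if_distrib[of "(*) _"] cong: if_cong)

context prob_space
begin

context
  fixes g :: "'a \<Rightarrow> real^'n"
  assumes g: "indep_normal_vector M g 0 (\<chi> i. 1)"
begin

lemma std_normal_vector_component: "distributed M lborel (\<lambda>\<omega>. g \<omega> $ i) std_normal_density"
  using g by (simp add: indep_normal_vector_def)

lemma std_normal_vector_indep: "indep_vars (\<lambda>_. borel) (\<lambda>i \<omega>. g \<omega> $ i) UNIV"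
  using g by (simp add: indep_normal_vector_def)

lemma std_normal_vector_measurable [measurable]: "g \<in> borel_measurable M"
  using g by (rule indep_normal_vector_measurable)

lemma std_normal_vector_nn_mgf:
  "(\<integral>\<^sup>+\<omega>. ennreal (exp (v \<bullet> g \<omega>)) \<partial>M) = ennreal (exp ((norm v)\<^sup>2 / 2))"
proof -
  have "(\<integral>\<^sup>+\<omega>. ennreal (exp (v \<bullet> g \<omega>)) \<partial>M)
      = (\<integral>\<^sup>+\<omega>. (\<Prod>i\<in>UNIV. ennreal (exp (v $ i * g \<omega> $ i))) \<partial>M)"
    by (simp add: inner_vec_def exp_sum prod_ennreal)
  also have "\<dots> = (\<Prod>i\<in>UNIV. \<integral>\<^sup>+\<omega>. ennreal (exp (v $ i * g \<omega> $ i)) \<partial>M)"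
    by (intro indep_vars_nn_integral indep_vars_compose2[OF std_normal_vector_indep]) auto
  also have "\<dots> = ennreal (exp ((norm v)\<^sup>2 / 2))"
    by (simp add: std_normal_nn_mgf[OF std_normal_vector_component] prod_ennreal exp_sum[symmetric]
        norm_vec_square sum_divide_distrib)
  finally show ?thesis .
qed

lemma std_normal_vector_char:
  "(CLINT \<omega>|M. iexp (v \<bullet> g \<omega>)) = complex_of_real (exp (- (norm v)\<^sup>2 / 2))"
proof -
  have "(CLINT \<omega>|M. iexp (v \<bullet> g \<omega>)) = (CLINT \<omega>|M. (\<Prod>i\<in>UNIV. iexp (v $ i * g \<omega> $ i)))"
    by (simp add: inner_vec_def exp_sum sum_distrib_left)
  also have "\<dots> = (\<Prod>i\<in>UNIV. CLINT \<omega>|M. iexp (v $ i * g \<omega> $ i))"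
  proof (rule indep_vars_lebesgue_integral)
    show "indep_vars (\<lambda>i. borel) (\<lambda>i \<omega>. iexp (v $ i * g \<omega> $ i)) UNIV"
      by (rule indep_vars_compose2[OF std_normal_vector_indep]) auto
    show "integrable M (\<lambda>\<omega>. iexp (v $ i * g \<omega> $ i))" for i
      by (rule integrable_const_bound[where B=1]) auto
  qed simp
  also have "\<dots> = complex_of_real (exp (- (norm v)\<^sup>2 / 2))"
    by (simp only: std_normal_expectation_iexp[OF std_normal_vector_component])
      (simp add: exp_sum[symmetric] of_real_prod[symmetric] norm_vec_square sum_divide_distrib sum_negf del: of_real_prod)
  finally show ?thesis .
qed

lemma nn_integral_exp_sum_squares:
  assumes s: "\<And>k. 2 * s k < 1"
  shows "(\<integral>\<^sup>+\<omega>. ennreal (exp (\<Sum>k\<in>UNIV. s k * (g \<omega> $ k)\<^sup>2)) \<partial>M)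
       = ennreal (\<Prod>k\<in>UNIV. 1 / sqrt (1 - 2 * s k))"
proof -
  have "(\<integral>\<^sup>+\<omega>. ennreal (exp (\<Sum>k\<in>UNIV. s k * (g \<omega> $ k)\<^sup>2)) \<partial>M)
      = (\<integral>\<^sup>+\<omega>. (\<Prod>k\<in>UNIV. ennreal (exp (s k * (g \<omega> $ k)\<^sup>2))) \<partial>M)"
    by (simp add: exp_sum prod_ennreal)
  also have "\<dots> = (\<Prod>k\<in>UNIV. \<integral>\<^sup>+\<omega>. ennreal (exp (s k * (g \<omega> $ k)\<^sup>2)) \<partial>M)"
    by (intro indep_vars_nn_integral indep_vars_compose2[OF std_normal_vector_indep]) auto
  also have "\<dots> = (\<Prod>k\<in>UNIV. ennreal (1 / sqrt (1 - 2 * s k)))"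
    using s by (simp add: std_normal_square_nn_mgf[OF std_normal_vector_component])
  also have "\<dots> = ennreal (\<Prod>k\<in>UNIV. 1 / sqrt (1 - 2 * s k))"
    using s by (intro prod_ennreal) (simp add: less_imp_le)
  finally show ?thesis .
qed

context
  fixes e :: "'n \<Rightarrow> real^'n"
  assumes e: "\<And>i j. e i \<bullet> e j = (if i = j then 1 else 0)"
begin

text \<open>The two readings of the bilinear exponent behind the linearization of squares: it is linear in
  \<open>z\<close> for fixed \<open>y\<close> and linear in \<open>y\<close> for fixed \<open>z\<close>.\<close>

lemma coupled_exponent:
  "(\<chi> k. r k * (e k \<bullet> y)) \<bullet> z = (\<Sum>k\<in>UNIV. (r k * z $ k) *\<^sub>R e k) \<bullet> y"
  by (simp add: inner_vec_def[of _ z] inner_sum_left mult_ac)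

text \<open>Rotation invariance of the Gaussian law, in the form needed for quadratic forms. Let \<open>g'\<close> be an
  independent copy of \<open>g\<close>. By the moment generating function of \<open>g'\<close>, the exponential of
  \<open>c\<^sub>k (e\<^sub>k \<bullet> g)\<^sup>2\<close> is the expectation over \<open>g'\<close> of the exponential of \<open>sqrt (2 c\<^sub>k) g'\<^sub>k (e\<^sub>k \<bullet> g)\<close>, which is
  linear in \<open>g\<close>. Integrating out \<open>g\<close> first leaves the squared norm of \<open>\<Sum>\<^sub>k sqrt (2 c\<^sub>k) g'\<^sub>k e\<^sub>k\<close>, and by
  orthonormality the basis disappears from it. The copy is the second factor of the product
  of the probability space with itself.\<close>

lemma nn_mgf_quadratic_rotate:
  assumes c: "\<And>k. c k \<ge> 0"
  shows "(\<integral>\<^sup>+\<omega>. ennreal (exp (\<Sum>k\<in>UNIV. c k * (e k \<bullet> g \<omega>)\<^sup>2)) \<partial>M)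
       = (\<integral>\<^sup>+\<omega>. ennreal (exp (\<Sum>k\<in>UNIV. c k * (g \<omega> $ k)\<^sup>2)) \<partial>M)"
proof -
  define r where "r k = sqrt (2 * c k)" for k
  have r: "(r k)\<^sup>2 = 2 * c k" for k using c by (simp add: r_def)
  define u where "u \<omega> = (\<chi> k. r k * (e k \<bullet> g \<omega>))" for \<omega>
  define v where "v \<omega>' = (\<Sum>k\<in>UNIV. (r k * g \<omega>' $ k) *\<^sub>R e k)" for \<omega>'
  have uv: "u \<omega> \<bullet> g \<omega>' = v \<omega>' \<bullet> g \<omega>" for \<omega> \<omega>'
    by (simp add: u_def v_def coupled_exponent)
  have [measurable]: "u \<in> borel_measurable M"
    unfolding u_def by (rule borel_measurable_vecI) simp
  interpret MM: pair_sigma_finite M M ..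
  have "(\<integral>\<^sup>+\<omega>. ennreal (exp (\<Sum>k\<in>UNIV. c k * (e k \<bullet> g \<omega>)\<^sup>2)) \<partial>M)
      = (\<integral>\<^sup>+\<omega>. ennreal (exp ((norm (u \<omega>))\<^sup>2 / 2)) \<partial>M)"
    by (simp add: norm_vec_square u_def power_mult_distrib r sum_divide_distrib)
  also have "\<dots> = (\<integral>\<^sup>+\<omega>. \<integral>\<^sup>+\<omega>'. ennreal (exp (u \<omega> \<bullet> g \<omega>')) \<partial>M \<partial>M)"
    by (simp add: std_normal_vector_nn_mgf)
  also have "\<dots> = (\<integral>\<^sup>+\<omega>'. \<integral>\<^sup>+\<omega>. ennreal (exp (u \<omega> \<bullet> g \<omega>')) \<partial>M \<partial>M)"
    by (rule MM.Fubini'[symmetric]) measurable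
  also have "\<dots> = (\<integral>\<^sup>+\<omega>'. ennreal (exp ((norm (v \<omega>'))\<^sup>2 / 2)) \<partial>M)"
    by (simp add: uv std_normal_vector_nn_mgf)
  also have "\<dots> = (\<integral>\<^sup>+\<omega>'. ennreal (exp (\<Sum>k\<in>UNIV. c k * (g \<omega>' $ k)\<^sup>2)) \<partial>M)"
    by (simp add: v_def norm_orthonormal_sum_square[OF e] power_mult_distrib r sum_divide_distrib)
  finally show ?thesis .
qed

text \<open>The same argument with the characteristic function in place of the moment generating function,
  which turns the sign of the exponent; all integrands are bounded, so Fubini applies.\<close>

lemma nn_mgf_negative_quadratic_rotate:
  assumes c: "\<And>k. c k \<ge> 0"
  shows "(\<integral>\<^sup>+\<omega>. ennreal (exp (- (\<Sum>k\<in>UNIV. c k * (e k \<bullet> g \<omega>)\<^sup>2))) \<partial>M)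
       = (\<integral>\<^sup>+\<omega>. ennreal (exp (- (\<Sum>k\<in>UNIV. c k * (g \<omega> $ k)\<^sup>2))) \<partial>M)"
proof -
  define r where "r k = sqrt (2 * c k)" for k
  have r: "(r k)\<^sup>2 = 2 * c k" for k using c by (simp add: r_def)
  define u where "u \<omega> = (\<chi> k. r k * (e k \<bullet> g \<omega>))" for \<omega>
  define v where "v \<omega>' = (\<Sum>k\<in>UNIV. (r k * g \<omega>' $ k) *\<^sub>R e k)" for \<omega>'
  have uv: "u \<omega> \<bullet> g \<omega>' = v \<omega>' \<bullet> g \<omega>" for \<omega> \<omega>'
    by (simp add: u_def v_def coupled_exponent)
  have [measurable]: "u \<in> borel_measurable M"
    unfolding u_def by (rule borel_measurable_vecI) simp
  interpret MM: pair_prob_space M M ..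
  have un: "exp (- (\<Sum>k\<in>UNIV. c k * (e k \<bullet> g \<omega>)\<^sup>2)) = exp (- (norm (u \<omega>))\<^sup>2 / 2)" for \<omega>
    by (simp add: norm_vec_square u_def power_mult_distrib r sum_divide_distrib sum_negf)
  have vn: "exp (- (\<Sum>k\<in>UNIV. c k * (g \<omega>' $ k)\<^sup>2)) = exp (- (norm (v \<omega>'))\<^sup>2 / 2)" for \<omega>'
    by (simp add: v_def norm_orthonormal_sum_square[OF e] power_mult_distrib r sum_divide_distrib sum_negf)
  have int: "integrable (M \<Otimes>\<^sub>M M) (\<lambda>(\<omega>, \<omega>'). iexp (u \<omega> \<bullet> g \<omega>'))"
    by (rule MM.P.integrable_const_bound[where B=1]) (auto simp: split_beta)
  have "complex_of_real (\<integral>\<omega>. exp (- (norm (u \<omega>))\<^sup>2 / 2) \<partial>M)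
      = (CLINT \<omega>|M. CLINT \<omega>'|M. iexp (u \<omega> \<bullet> g \<omega>'))"
    unfolding std_normal_vector_char by (rule integral_complex_of_real[symmetric])
  also have "\<dots> = (CLINT \<omega>'|M. CLINT \<omega>|M. iexp (u \<omega> \<bullet> g \<omega>'))"
    by (rule MM.Fubini_integral[OF int, symmetric])
  also have "\<dots> = complex_of_real (\<integral>\<omega>. exp (- (norm (v \<omega>))\<^sup>2 / 2) \<partial>M)"
    unfolding uv std_normal_vector_char by (rule integral_complex_of_real)
  finally have eq: "(\<integral>\<omega>. exp (- (norm (u \<omega>))\<^sup>2 / 2) \<partial>M) = (\<integral>\<omega>. exp (- (norm (v \<omega>))\<^sup>2 / 2) \<partial>M)"
    by (simp only: of_real_eq_iff)
  have [measurable]: "v \<in> borel_measurable M"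
    unfolding v_def by measurable
  have "integrable M (\<lambda>\<omega>. exp (- (norm (u \<omega>))\<^sup>2 / 2))" "integrable M (\<lambda>\<omega>. exp (- (norm (v \<omega>))\<^sup>2 / 2))"
    by (auto intro!: integrable_const_bound[where B=1])
  then show ?thesis
    unfolding un vn by (subst (1 2) nn_integral_eq_integral) (use eq in auto)
qed

end
end
end

section \<open>Deviation bounds for linear and quadratic forms\<close>

lemma inverse_sqrt_eq_exp: "1 / sqrt z = exp (- ln z / 2)" if "z > 0" for z :: real
proof -
  have "sqrt z = exp (ln z / 2)" using that powr_half_sqrt[of z] by (simp add: powr_def)
  then show ?thesis by (simp add: exp_minus inverse_eq_divide)
qed

text \<open>Both sides agree at \<open>s = 0\<close>, and the difference of their logarithms has the nonnegative derivative
  \<open>2 s\<^sup>2 / (1 - 2 s)\<^sup>2\<close>; in the next lemma it is \<open>4 s\<^sup>2 / (1 + 2 s)\<close>. The left sides are the values of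
  the moment generating function of a squared standard normal variable at \<open>s\<close> and \<open>- s\<close>.\<close>

lemma inverse_sqrt_le_exp_pos:
  fixes s :: real
  assumes s: "0 \<le> s" "2 * s < 1"
  shows "1 / sqrt (1 - 2 * s) \<le> exp (s + s\<^sup>2 / (1 - 2 * s))"
proof -
  define h where "h s = s + s\<^sup>2 / (1 - 2 * s) + ln (1 - 2 * s) / 2" for s :: real
  have "h 0 \<le> h s"
  proof (rule DERIV_nonneg_imp_nondecreasing[OF s(1)])
    fix y assume y: "0 \<le> y" "y \<le> s"
    then have d: "1 - 2 * y > 0" using s by simp
    then have q: "4 / (4 - 8 * y) = 1 / (1 - 2 * y)" by (simp add: divide_simps)
    have "(h has_real_derivative (1 + (2 * y * (1 - 2 * y) + 2 * y\<^sup>2) / (1 - 2 * y)\<^sup>2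
        - 1 / (1 - 2 * y))) (at y)"
      unfolding h_def using d q
      by (auto intro!: derivative_eq_intros simp: power2_eq_square mult.commute)
    moreover have "1 + (2 * y * (1 - 2 * y) + 2 * y\<^sup>2) / (1 - 2 * y)\<^sup>2 - 1 / (1 - 2 * y)
        = 2 * y\<^sup>2 / (1 - 2 * y)\<^sup>2"
      using d by (simp add: divide_simps power2_eq_square) (simp add: algebra_simps)
    ultimately show "\<exists>D. (h has_real_derivative D) (at y) \<and> 0 \<le> D" by force
  qed
  then have "- ln (1 - 2 * s) / 2 \<le> s + s\<^sup>2 / (1 - 2 * s)" by (simp add: h_def)
  then show ?thesis using s by (simp add: inverse_sqrt_eq_exp)
qed

lemma inverse_sqrt_le_exp_neg:
  fixes s :: real
  assumes s: "0 \<le> s"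
  shows "1 / sqrt (1 + 2 * s) \<le> exp (- s + s\<^sup>2)"
proof -
  define h where "h s = - s + s\<^sup>2 + ln (1 + 2 * s) / 2" for s :: real
  have "h 0 \<le> h s"
  proof (rule DERIV_nonneg_imp_nondecreasing[OF s])
    fix y assume y: "0 \<le> y" "y \<le> s"
    then have d: "1 + 2 * y > 0" by simp
    then have q: "4 / (4 + 8 * y) = 1 / (1 + 2 * y)" by (simp add: divide_simps)
    have "(h has_real_derivative (- 1 + 2 * y + 1 / (1 + 2 * y))) (at y)"
      unfolding h_def using d q by (auto intro!: derivative_eq_intros)
    moreover have "- 1 + 2 * y + 1 / (1 + 2 * y) = 4 * y\<^sup>2 / (1 + 2 * y)"
      using d by (simp add: divide_simps power2_eq_square) (simp add: algebra_simps)
    ultimately show "\<exists>D. (h has_real_derivative D) (at y) \<and> 0 \<le> D" using d by force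
  qed
  then have "- ln (1 + 2 * s) / 2 \<le> - s + s\<^sup>2" by (simp add: h_def)
  then show ?thesis using s by (simp add: inverse_sqrt_eq_exp)
qed

lemma (in prob_space) Chernoff_bound:
  assumes [measurable]: "Z \<in> borel_measurable M" and s: "s > 0"
    and mgf: "(\<integral>\<^sup>+\<omega>. ennreal (exp (s * Z \<omega>)) \<partial>M) \<le> ennreal (exp m)"
    and m: "m - s * a \<le> - x"
  shows "prob {\<omega> \<in> space M. Z \<omega> \<ge> a} \<le> exp (- x)"
proof -
  have "emeasure M {\<omega> \<in> space M. Z \<omega> \<ge> a}
      \<le> ennreal (exp (- s * a)) * (\<integral>\<^sup>+\<omega>. ennreal (exp (s * Z \<omega>)) * indicator (space M) \<omega> \<partial>M)"
    by (rule Chernoff_ineq_nn_integral_ge[OF s]) auto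
  also have "(\<integral>\<^sup>+\<omega>. ennreal (exp (s * Z \<omega>)) * indicator (space M) \<omega> \<partial>M)
      = (\<integral>\<^sup>+\<omega>. ennreal (exp (s * Z \<omega>)) \<partial>M)"
    by (rule nn_integral_cong) simp
  also have "ennreal (exp (- s * a)) * \<dots> \<le> ennreal (exp (- s * a)) * ennreal (exp m)"
    by (rule mult_left_mono[OF mgf]) simp
  also have "\<dots> = ennreal (exp (m - s * a))"
    by (simp add: ennreal_mult[symmetric] exp_add[symmetric])
  also have "\<dots> \<le> ennreal (exp (- x))" using m by (intro ennreal_leI) simp
  finally show ?thesis by (simp add: emeasure_eq_measure)
qed

context prob_space
begin

lemma std_normal_linear_deviation:
  fixes g :: "'a \<Rightarrow> real^'n"
  assumes g: "indep_normal_vector M g 0 (\<chi> i. 1)"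
    and u: "norm u \<le> c" and c: "c > 0" and x: "x > 0"
  shows "prob {\<omega> \<in> space M. u \<bullet> g \<omega> \<ge> c * sqrt (2 * x)} \<le> exp (- x)"
proof -
  have [measurable]: "g \<in> borel_measurable M" by (rule std_normal_vector_measurable[OF g])
  define s where "s = sqrt (2 * x) / c"
  have s: "s > 0" "s * c = sqrt (2 * x)" using c x by (auto simp: s_def)
  show ?thesis
  proof (rule Chernoff_bound[OF _ s(1)])
    have "(\<integral>\<^sup>+\<omega>. ennreal (exp (s * (u \<bullet> g \<omega>))) \<partial>M) = ennreal (exp ((norm (s *\<^sub>R u))\<^sup>2 / 2))"
      using std_normal_vector_nn_mgf[OF g, of "s *\<^sub>R u"] by simp
    also have "\<dots> \<le> ennreal (exp x)"
    proof -
      have "norm (s *\<^sub>R u) \<le> sqrt (2 * x)"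
        using mult_left_mono[OF u, of s] s by simp
      from power_mono[OF this, of 2] show ?thesis using x by (intro ennreal_leI) simp
    qed
    finally show "(\<integral>\<^sup>+\<omega>. ennreal (exp (s * (u \<bullet> g \<omega>))) \<partial>M) \<le> ennreal (exp x)" .
    have "s * (c * sqrt (2 * x)) = (sqrt (2 * x))\<^sup>2"
      using s(2) by (simp add: power2_eq_square mult.assoc[symmetric])
    then show "x - s * (c * sqrt (2 * x)) \<le> - x" using x by simp
  qed measurable
qed

text \<open>Deviation bounds of Laurent and Massart for a Gaussian quadratic form with eigenvalues \<open>l k \<le> b\<close>.
  The logarithm of the moment generating function of \<open>Z\<close> at \<open>t > 0\<close> is at most
  \<open>t\<^sup>2 v\<^sup>2 / (1 - 2 t b)\<close> as long as \<open>2 t b < 1\<close>, and that of \<open>- Z\<close> is at most \<open>t\<^sup>2 v\<^sup>2\<close>. The parameters \<open>t\<close> chosen below make the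
  exponent in the Chernoff bound equal to \<open>- x\<close>.\<close>

lemma
  fixes g :: "'a \<Rightarrow> real^'n" and e :: "'n \<Rightarrow> real^'n" and l :: "'n \<Rightarrow> real"
  assumes g: "indep_normal_vector M g 0 (\<chi> i. 1)"
    and e: "\<And>i j. e i \<bullet> e j = (if i = j then 1 else 0)"
    and l: "\<And>k. 0 \<le> l k" "\<And>k. l k \<le> b" and v: "(\<Sum>k\<in>UNIV. (l k)\<^sup>2) \<le> v\<^sup>2" "v > 0"
    and x: "x > 0"
  defines "Z \<equiv> \<lambda>\<omega>. (\<Sum>k\<in>UNIV. l k * (e k \<bullet> g \<omega>)\<^sup>2) - (\<Sum>k\<in>UNIV. l k)"
  shows std_normal_quadratic_upper_deviation:
      "prob {\<omega> \<in> space M. Z \<omega> \<ge> 2 * v * sqrt x + 2 * b * x} \<le> exp (- x)"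
    and std_normal_quadratic_lower_deviation:
      "prob {\<omega> \<in> space M. - Z \<omega> \<ge> 2 * v * sqrt x} \<le> exp (- x)"
proof -
  have [measurable]: "g \<in> borel_measurable M" by (rule std_normal_vector_measurable[OF g])
  have [measurable]: "Z \<in> borel_measurable M" unfolding Z_def by measurable
  have b: "b \<ge> 0" using l by (metis order_trans)
  have sx: "sqrt x > 0" "sqrt x * sqrt x = x" using x by auto
  show "prob {\<omega> \<in> space M. Z \<omega> \<ge> 2 * v * sqrt x + 2 * b * x} \<le> exp (- x)"
  proof -
    \<comment> \<open>With \<open>t = sqrt x / D\<close> the denominator \<open>1 - 2 t b\<close> becomes \<open>v / D\<close>.\<close>
    define D where "D = v + 2 * b * sqrt x"
    have D: "D > 0" "D \<ge> v" using v b sx by (auto simp: D_def add_pos_nonneg)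
    define t where "t = sqrt x / D"
    have t: "t > 0" using D sx by (simp add: t_def)
    have tb: "1 - 2 * (t * b) = v / D" using D by (simp add: t_def field_simps) (simp add: D_def)
    have tl: "1 - 2 * (t * l k) \<ge> v / D" "0 \<le> t * l k" for k
      using mult_left_mono[OF l(2), of t k] t l(1)[of k] by (auto simp: tb[symmetric])
    have vD: "v / D > 0" using v D by simp
    have tl1: "2 * (t * l k) < 1" for k using tl(1)[of k] vD by linarith
    define m where "m = t\<^sup>2 * v * D"
    have "(\<integral>\<^sup>+\<omega>. ennreal (exp (t * Z \<omega>)) \<partial>M)
        = (\<integral>\<^sup>+\<omega>. ennreal (exp (- (\<Sum>k\<in>UNIV. t * l k))) *
             ennreal (exp (\<Sum>k\<in>UNIV. (t * l k) * (e k \<bullet> g \<omega>)\<^sup>2)) \<partial>M)"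
      by (simp add: Z_def ennreal_mult[symmetric] exp_add[symmetric] sum_distrib_left
          right_diff_distrib mult.assoc)
    also have "\<dots> = ennreal (exp (- (\<Sum>k\<in>UNIV. t * l k))) *
        ennreal (\<Prod>k\<in>UNIV. 1 / sqrt (1 - 2 * (t * l k)))"
      using nn_mgf_quadratic_rotate[OF g e, of "\<lambda>k. t * l k"] tl(2)
        nn_integral_exp_sum_squares[OF g, of "\<lambda>k. t * l k"] tl1
      by (simp add: nn_integral_cmult)
    also have "\<dots> \<le> ennreal (exp (- (\<Sum>k\<in>UNIV. t * l k))) *
        ennreal (\<Prod>k\<in>UNIV. exp (t * l k + (t * l k)\<^sup>2 * D / v))"
    proof (intro mult_left_mono ennreal_leI prod_mono conjI)
      fix k
      show "0 \<le> 1 / sqrt (1 - 2 * (t * l k))" using tl1[of k] by simp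
      have "(t * l k)\<^sup>2 / (1 - 2 * (t * l k)) \<le> (t * l k)\<^sup>2 / (v / D)"
        using tl(1)[of k] tl1[of k] vD by (intro divide_left_mono mult_pos_pos) auto
      then show "1 / sqrt (1 - 2 * (t * l k)) \<le> exp (t * l k + (t * l k)\<^sup>2 * D / v)"
        by (intro order_trans[OF inverse_sqrt_le_exp_pos[OF tl(2) tl1]]) simp
    qed simp
    also have "\<dots> = ennreal (exp (\<Sum>k\<in>UNIV. (t * l k)\<^sup>2 * D / v))"
      by (simp add: ennreal_mult[symmetric] exp_add[symmetric] exp_sum[symmetric] sum.distrib)
    also have "\<dots> \<le> ennreal (exp m)"
    proof -
      have "(\<Sum>k\<in>UNIV. (t * l k)\<^sup>2 * D / v) = t\<^sup>2 * D / v * (\<Sum>k\<in>UNIV. (l k)\<^sup>2)"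
        by (simp add: sum_distrib_left sum_divide_distrib power_mult_distrib mult_ac)
      also have "\<dots> \<le> t\<^sup>2 * D / v * v\<^sup>2" using v D by (intro mult_left_mono) auto
      also have "\<dots> = m" using v by (simp add: m_def power2_eq_square)
      finally show ?thesis by (intro ennreal_leI) simp
    qed
    finally have mgf: "(\<integral>\<^sup>+\<omega>. ennreal (exp (t * Z \<omega>)) \<partial>M) \<le> ennreal (exp m)" .
    have tD: "t * D = sqrt x" using D by (simp add: t_def)
    have "m - t * (2 * v * sqrt x + 2 * b * x) = t * v * (t * D) - t * sqrt x * (2 * v + 2 * b * sqrt x)"
      using x by (simp add: m_def power2_eq_square algebra_simps sx(2))
    also have "\<dots> = t * v * sqrt x - t * sqrt x * (2 * v + 2 * b * sqrt x)" by (simp only: tD)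
    also have "\<dots> = - (t * D * sqrt x)" by (simp add: D_def algebra_simps)
    also have "\<dots> = - x" by (simp only: tD sx(2))
    finally have ex: "m - t * (2 * v * sqrt x + 2 * b * x) \<le> - x" by simp
    show ?thesis by (rule Chernoff_bound[OF _ t mgf ex]) measurable
  qed
  show "prob {\<omega> \<in> space M. - Z \<omega> \<ge> 2 * v * sqrt x} \<le> exp (- x)"
  proof -
    define t where "t = sqrt x / v"
    have t: "t > 0" "t * v = sqrt x" using v sx by (auto simp: t_def)
    have tl: "0 \<le> t * l k" for k using t l by simp
    have tl1: "2 * (- (t * l k)) < 1" for k using tl[of k] by linarith
    have "(\<integral>\<^sup>+\<omega>. ennreal (exp (t * - Z \<omega>)) \<partial>M)
        = (\<integral>\<^sup>+\<omega>. ennreal (exp (\<Sum>k\<in>UNIV. t * l k)) *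
             ennreal (exp (- (\<Sum>k\<in>UNIV. (t * l k) * (e k \<bullet> g \<omega>)\<^sup>2))) \<partial>M)"
      by (simp add: Z_def ennreal_mult[symmetric] exp_add[symmetric] sum_distrib_left
          right_diff_distrib mult.assoc)
    also have "\<dots> = ennreal (exp (\<Sum>k\<in>UNIV. t * l k)) *
        ennreal (\<Prod>k\<in>UNIV. 1 / sqrt (1 + 2 * (t * l k)))"
      using nn_mgf_negative_quadratic_rotate[OF g e, of "\<lambda>k. t * l k"] tl
        nn_integral_exp_sum_squares[OF g, of "\<lambda>k. - (t * l k)"] tl1
      by (simp add: nn_integral_cmult sum_negf)
    also have "\<dots> \<le> ennreal (exp (\<Sum>k\<in>UNIV. t * l k)) *
        ennreal (\<Prod>k\<in>UNIV. exp (- (t * l k) + (t * l k)\<^sup>2))"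
      using inverse_sqrt_le_exp_neg[OF tl] tl
      by (intro mult_left_mono ennreal_leI prod_mono conjI) auto
    also have "\<dots> = ennreal (exp (t\<^sup>2 * (\<Sum>k\<in>UNIV. (l k)\<^sup>2)))"
      by (simp add: ennreal_mult[symmetric] exp_add[symmetric] exp_sum[symmetric] sum.distrib
          sum_negf sum_subtractf sum_distrib_left power_mult_distrib)
    also have "\<dots> \<le> ennreal (exp (t\<^sup>2 * v\<^sup>2))"
      using v by (intro ennreal_leI) (simp add: mult_left_mono)
    also have "t\<^sup>2 * v\<^sup>2 = x" using t(2) sx by (simp add: power_mult_distrib[symmetric])
    finally have mgf: "(\<integral>\<^sup>+\<omega>. ennreal (exp (t * - Z \<omega>)) \<partial>M) \<le> ennreal (exp x)" .
    have "t * (2 * v * sqrt x) = 2 * (t * v * sqrt x)" by simp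
    also have "\<dots> = 2 * x" by (simp only: t(2) sx(2))
    finally have "t * (2 * v * sqrt x) = 2 * x" .
    then have ex: "x - t * (2 * v * sqrt x) \<le> - x" by simp
    show ?thesis by (rule Chernoff_bound[OF _ t(1) mgf ex]) measurable
  qed
qed

end

section \<open>The conditional expectation of the bootstrap variance\<close>

context prob_space
begin

lemma std_normal_vector_moments:
  fixes g :: "'a \<Rightarrow> real^'n"
  assumes g: "indep_normal_vector M g 0 (\<chi> i. 1)"
  shows "integrable M (\<lambda>\<omega>. g \<omega> $ i)" "(\<integral>\<omega>. g \<omega> $ i \<partial>M) = 0"
    and "integrable M (\<lambda>\<omega>. g \<omega> $ i * g \<omega> $ j)"
    and "(\<integral>\<omega>. g \<omega> $ i * g \<omega> $ j \<partial>M) = (if i = j then 1 else 0)"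
proof -
  note D = std_normal_vector_component[OF g]
  have i1: "integrable M (\<lambda>\<omega>. g \<omega> $ i)" for i
    using integrable_std_normal_moment[of 1]
    by (subst distributed_integrable[OF D, symmetric, where g="\<lambda>y. y"]) auto
  have e0: "(\<integral>\<omega>. g \<omega> $ i \<partial>M) = 0" for i
    using standard_normal_distributed_expectation[OF D] by simp
  have i2: "integrable M (\<lambda>\<omega>. g \<omega> $ i * g \<omega> $ i)" for i
    using integrable_std_normal_moment[of 2]
    by (subst distributed_integrable[OF D, symmetric, where g="\<lambda>y. y * y"]) (auto simp: power2_eq_square)
  have e1: "(\<integral>\<omega>. g \<omega> $ i * g \<omega> $ i \<partial>M) = 1" for i
    using standard_normal_distributed_variance[OF D[of i]] by (simp add: e0 power2_eq_square)
  have ind: "indep_vars (\<lambda>_. borel) (\<lambda>i \<omega>. g \<omega> $ i) {i, j}"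
    by (rule indep_vars_subset[OF std_normal_vector_indep[OF g]]) simp
  show "integrable M (\<lambda>\<omega>. g \<omega> $ i)" "(\<integral>\<omega>. g \<omega> $ i \<partial>M) = 0" by fact+
  show "integrable M (\<lambda>\<omega>. g \<omega> $ i * g \<omega> $ j)"
    using i2 indep_vars_integrable[OF _ ind i1] by (cases "i = j") auto
  show "(\<integral>\<omega>. g \<omega> $ i * g \<omega> $ j \<partial>M) = (if i = j then 1 else 0)"
    using e1 e0 indep_vars_lebesgue_integral[OF _ ind i1] by (cases "i = j") auto
qed

lemma std_normal_vector_linear_moments:
  fixes g :: "'a \<Rightarrow> real^'n"
  assumes g: "indep_normal_vector M g 0 (\<chi> i. 1)"
  shows "integrable M (\<lambda>\<omega>. u \<bullet> g \<omega>)" "(\<integral>\<omega>. u \<bullet> g \<omega> \<partial>M) = 0"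
    and "integrable M (\<lambda>\<omega>. (u \<bullet> g \<omega>) * (v \<bullet> g \<omega>))"
    and "(\<integral>\<omega>. (u \<bullet> g \<omega>) * (v \<bullet> g \<omega>) \<partial>M) = u \<bullet> v"
proof -
  note m = std_normal_vector_moments[OF g]
  show "integrable M (\<lambda>\<omega>. u \<bullet> g \<omega>)" "(\<integral>\<omega>. u \<bullet> g \<omega> \<partial>M) = 0"
    by (simp_all add: inner_vec_def m)
  have *: "(u \<bullet> g \<omega>) * (v \<bullet> g \<omega>) = (\<Sum>i\<in>UNIV. \<Sum>j\<in>UNIV. (u $ i * v $ j) * (g \<omega> $ i * g \<omega> $ j))" for \<omega>
    by (simp add: inner_vec_def sum_product mult_ac)
  show "integrable M (\<lambda>\<omega>. (u \<bullet> g \<omega>) * (v \<bullet> g \<omega>))"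
    unfolding * by (intro Bochner_Integration.integrable_sum integrable_mult_right m)
  have "(\<integral>\<omega>. (u \<bullet> g \<omega>) * (v \<bullet> g \<omega>) \<partial>M)
      = (\<Sum>i\<in>UNIV. \<Sum>j\<in>UNIV. (u $ i * v $ j) * (\<integral>\<omega>. g \<omega> $ i * g \<omega> $ j \<partial>M))"
    unfolding * by (simp add: m(3) Bochner_Integration.integral_sum)
  then show "(\<integral>\<omega>. (u \<bullet> g \<omega>) * (v \<bullet> g \<omega>) \<partial>M) = u \<bullet> v"
    by (simp add: m(4) inner_vec_def if_distrib[of "(*) _"] cong: if_cong)
qed

text \<open>Expanding the square gives the terms \<open>h\<^sub>i(Y) h\<^sub>j(Y) w\<^sub>i w\<^sub>j\<close> with coefficients \<open>K\<^sub>i \<bullet> K\<^sub>j\<close> formed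
  from the columns of \<open>K\<close>. Over an event determined by \<open>Y\<close> each integral factorizes by independence,
  and \<open>w\<close> contributes the identity matrix, so only the diagonal survives.\<close>

lemma cond_exp_given_weighted_gaussian:
  fixes Y w :: "'a \<Rightarrow> real^'n" and h :: "real^'n \<Rightarrow> real^'n" and K :: "real^'n^'q"
  assumes w: "indep_normal_vector M w 0 (\<chi> i. 1)"
    and ind: "indep_var borel Y borel w"
    and h [measurable]: "h \<in> borel_measurable borel"
    and int: "\<And>i j. integrable M (\<lambda>\<omega>. h (Y \<omega>) $ i * h (Y \<omega>) $ j)"
  shows "AE \<omega> in M. cond_exp_given M Y (\<lambda>\<omega>. (norm (K *v (diag_mat (h (Y \<omega>)) *v w \<omega>)))\<^sup>2) \<omega>
    = (\<Sum>i\<in>UNIV. (norm (column i K))\<^sup>2 * (h (Y \<omega>) $ i)\<^sup>2)"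
proof -
  have Y [measurable]: "Y \<in> borel_measurable M" by (rule indep_var_rv1[OF ind])
  have [measurable]: "w \<in> borel_measurable M" by (rule indep_var_rv2[OF ind])
  define F where "F = vimage_algebra (space M) Y borel"
  have "subalgebra M F"
    using measurable_sets[OF Y]
    by (auto simp: subalgebra_def F_def sets_vimage_algebra2)
  then interpret F: finite_measure_subalgebra M F by unfold_locales
  have YF: "Y \<in> borel_measurable F"
    unfolding F_def by (rule measurable_vimage_algebra1) simp
  note m = std_normal_vector_moments[OF w]
  define k where "k i j = column i K \<bullet> column j K" for i j
  have expand: "(norm (K *v (diag_mat y *v z)))\<^sup>2
      = (\<Sum>i\<in>UNIV. \<Sum>j\<in>UNIV. k i j * ((y $ i * y $ j) * (z $ i * z $ j)))" for y z
  proof -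
    have "K *v (diag_mat y *v z) = (\<Sum>i\<in>UNIV. (y $ i * z $ i) *\<^sub>R column i K)"
      by (simp add: matrix_mult_sum[of K] diag_mat_mult_vec scalar_mult_eq_scaleR)
    then show ?thesis
      unfolding power2_norm_eq_inner by (simp add: inner_sum_left inner_sum_right k_def
          sum_distrib_left inner_commute mult_ac)
  qed
  have prod: "integrable M (\<lambda>\<omega>. (s (Y \<omega>) * (h (Y \<omega>) $ i * h (Y \<omega>) $ j)) * (w \<omega> $ i * w \<omega> $ j))"
    "(\<integral>\<omega>. (s (Y \<omega>) * (h (Y \<omega>) $ i * h (Y \<omega>) $ j)) * (w \<omega> $ i * w \<omega> $ j) \<partial>M)
     = (\<integral>\<omega>. s (Y \<omega>) * (h (Y \<omega>) $ i * h (Y \<omega>) $ j) \<partial>M) * (if i = j then 1 else 0)"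
    if [measurable]: "s \<in> borel_measurable borel" and s: "\<And>y. \<bar>s y\<bar> \<le> 1" for s :: "real^'n \<Rightarrow> real" and i j
  proof -
    have "indep_var borel ((\<lambda>y. s y * (h y $ i * h y $ j)) \<circ> Y) borel ((\<lambda>z. z $ i * z $ j) \<circ> w)"
      by (rule indep_var_compose[OF ind]) measurable
    then have iv: "indep_var borel (\<lambda>\<omega>. s (Y \<omega>) * (h (Y \<omega>) $ i * h (Y \<omega>) $ j))
        borel (\<lambda>\<omega>. w \<omega> $ i * w \<omega> $ j)" by (simp add: comp_def)
    have isY: "integrable M (\<lambda>\<omega>. s (Y \<omega>) * (h (Y \<omega>) $ i * h (Y \<omega>) $ j))"
      by (rule Bochner_Integration.integrable_bound[OF int[of i j]])
        (use mult_right_mono[OF s] in \<open>auto simp: abs_mult\<close>)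
    show "integrable M (\<lambda>\<omega>. (s (Y \<omega>) * (h (Y \<omega>) $ i * h (Y \<omega>) $ j)) * (w \<omega> $ i * w \<omega> $ j))"
      by (rule indep_var_integrable[OF iv isY m(3)])
    show "(\<integral>\<omega>. (s (Y \<omega>) * (h (Y \<omega>) $ i * h (Y \<omega>) $ j)) * (w \<omega> $ i * w \<omega> $ j) \<partial>M)
     = (\<integral>\<omega>. s (Y \<omega>) * (h (Y \<omega>) $ i * h (Y \<omega>) $ j) \<partial>M) * (if i = j then 1 else 0)"
      using indep_var_lebesgue_integral[OF iv isY m(3)] by (simp add: m(4))
  qed
  show ?thesis
    unfolding cond_exp_given_def F_def[symmetric]
  proof (rule F.real_cond_exp_charact)
    fix A assume "A \<in> sets F"
    then obtain C where C [measurable]: "C \<in> sets borel" and A: "A = Y -` C \<inter> space M"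
      by (auto simp: F_def sets_vimage_algebra2)
    define s where "s = (indicator C :: real^'n \<Rightarrow> real)"
    have s [measurable]: "s \<in> borel_measurable borel" "\<And>y. \<bar>s y\<bar> \<le> 1"
      by (auto simp: s_def indicator_def)
    have "(\<integral>\<omega>\<in>A. (norm (K *v (diag_mat (h (Y \<omega>)) *v w \<omega>)))\<^sup>2 \<partial>M)
        = (\<integral>\<omega>. (\<Sum>i\<in>UNIV. \<Sum>j\<in>UNIV.
            k i j * ((s (Y \<omega>) * (h (Y \<omega>) $ i * h (Y \<omega>) $ j)) * (w \<omega> $ i * w \<omega> $ j))) \<partial>M)"
      unfolding set_lebesgue_integral_def expand
      by (rule Bochner_Integration.integral_cong)
        (auto simp: A s_def sum_distrib_left mult_ac indicator_def)
    also have "\<dots> = (\<Sum>i\<in>UNIV. \<Sum>j\<in>UNIV.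
        k i j * ((\<integral>\<omega>. s (Y \<omega>) * (h (Y \<omega>) $ i * h (Y \<omega>) $ j) \<partial>M) * (if i = j then 1 else 0)))"
      by (simp add: prod[OF s] Bochner_Integration.integral_sum Bochner_Integration.integrable_sum)
    also have "\<dots> = (\<Sum>i\<in>UNIV. (norm (column i K))\<^sup>2 * (\<integral>\<omega>. s (Y \<omega>) * (h (Y \<omega>) $ i * h (Y \<omega>) $ i) \<partial>M))"
      by (simp add: if_distrib[of "(*) _"] k_def power2_norm_eq_inner cong: if_cong)
    also have "\<dots> = (\<integral>\<omega>\<in>A. (\<Sum>i\<in>UNIV. (norm (column i K))\<^sup>2 * (h (Y \<omega>) $ i)\<^sup>2) \<partial>M)"
    proof -
      have isY: "integrable M (\<lambda>\<omega>. s (Y \<omega>) * (h (Y \<omega>) $ i * h (Y \<omega>) $ i))" for i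
        by (rule Bochner_Integration.integrable_bound[OF int[of i i]])
          (use mult_right_mono[OF s(2)] in \<open>auto simp: abs_mult\<close>)
      have "(\<integral>\<omega>\<in>A. (\<Sum>i\<in>UNIV. (norm (column i K))\<^sup>2 * (h (Y \<omega>) $ i)\<^sup>2) \<partial>M)
          = (\<integral>\<omega>. (\<Sum>i\<in>UNIV. (norm (column i K))\<^sup>2 * (s (Y \<omega>) * (h (Y \<omega>) $ i * h (Y \<omega>) $ i))) \<partial>M)"
        unfolding set_lebesgue_integral_def
        by (rule Bochner_Integration.integral_cong)
          (auto simp: A s_def sum_distrib_left mult_ac indicator_def power2_eq_square)
      then show ?thesis by (simp add: isY Bochner_Integration.integral_sum)
    qed
    finally show "(\<integral>\<omega>\<in>A. (norm (K *v (diag_mat (h (Y \<omega>)) *v w \<omega>)))\<^sup>2 \<partial>M)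
      = (\<integral>\<omega>\<in>A. (\<Sum>i\<in>UNIV. (norm (column i K))\<^sup>2 * (h (Y \<omega>) $ i)\<^sup>2) \<partial>M)" .
  next
    show "integrable M (\<lambda>\<omega>. (norm (K *v (diag_mat (h (Y \<omega>)) *v w \<omega>)))\<^sup>2)"
      unfolding expand using prod(1)[of "\<lambda>_. 1"]
      by (intro Bochner_Integration.integrable_sum integrable_mult_right) auto
    show "integrable M (\<lambda>\<omega>. \<Sum>i\<in>UNIV. (norm (column i K))\<^sup>2 * (h (Y \<omega>) $ i)\<^sup>2)"
      using int by (auto simp: power2_eq_square)
    show "(\<lambda>\<omega>. \<Sum>i\<in>UNIV. (norm (column i K))\<^sup>2 * (h (Y \<omega>) $ i)\<^sup>2) \<in> borel_measurable F"
      using YF by measurable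
  qed
qed

section \<open>Deviation of a weighted sum of squared residuals\<close>

text \<open>The probabilistic core, for residuals \<open>b + L g\<close> with bias \<open>b\<close> and covariance \<open>L L\<^sup>T \<le> 2 I\<close>. The
  weighted sum minus one is the sum of
    \<^item> the squared bias, between \<open>0\<close> and \<open>(infnorm b)\<^sup>2\<close>;
    \<^item> the cross term \<open>u \<bullet> g\<close>, where \<open>\<parallel>u\<parallel>\<^sup>2 \<le> 8 d\<^sup>4 \<parallel>b\<parallel>\<^sup>2\<close> because every weight is at most \<open>d\<^sup>2\<close>;
    \<^item> the centered quadratic form \<open>Z\<close> in \<open>g\<close>, given by \<open>Q = L\<^sup>T diag(a) L\<close>;
    \<^item> the trace of \<open>Q\<close> minus one, a weighted mean of the deviations of the residual variances from one.

  The eigenvalues of \<open>Q\<close> are at most \<open>2 d\<^sup>2\<close> and their sum, the trace, is at most \<open>2\<close>, so their squares add up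
  to at most \<open>(2 d)\<^sup>2\<close>. The exceptional event collects the two tails of the cross term and the two
  tails of \<open>Z\<close>.\<close>

lemma weighted_square_residual_deviation:
  fixes g :: "'a \<Rightarrow> real^'n" and L :: "real^'n^'n" and a :: "'n \<Rightarrow> real" and b :: "real^'n"
  assumes g: "indep_normal_vector M g 0 (\<chi> i. 1)"
    and a: "\<And>i. 0 \<le> a i" "(\<Sum>i\<in>UNIV. a i) = 1" "\<And>i. a i \<le> d\<^sup>2" and d: "d > 0"
    and L: "\<And>v. (norm (transpose L *v v))\<^sup>2 \<le> 2 * (norm v)\<^sup>2"
    and de: "\<And>i. \<bar>(norm (L $ i))\<^sup>2 - 1\<bar> \<le> \<delta>" and x: "x > 0"
  obtains E where "E \<in> sets M" "prob E \<le> 4 * exp (- x)"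
    "\<And>\<omega>. \<omega> \<in> space M - E \<Longrightarrow>
      \<bar>(\<Sum>i\<in>UNIV. a i * (b $ i + (L *v g \<omega>) $ i)\<^sup>2) - 1\<bar> \<le> Delta_p x b d \<delta>"
proof -
  note [simp del] = transpose_matrix_vector
  have [measurable]: "g \<in> borel_measurable M" by (rule std_normal_vector_measurable[OF g])
  note Lc = matrix_vector_mul_component[of L]
  have adj: "(transpose L *v y) \<bullet> z = y \<bullet> (L *v z)" for y z
    by (metis dot_lmul_matrix transpose_matrix_vector)
  have rowL: "(norm (L $ i))\<^sup>2 \<le> 2" for i
  proof -
    have "transpose L *v axis i 1 = L $ i"
      by (simp add: matrix_vector_mult_basis column_def transpose_def vec_eq_iff)
    then show ?thesis using L[of "axis i 1"] by simp
  qed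
  \<comment> \<open>A matrix and its transpose have the same operator norm.\<close>
  have Lv: "(norm (L *v y))\<^sup>2 \<le> 2 * (norm y)\<^sup>2" for y
  proof (cases "L *v y = 0")
    case False
    have "((norm (L *v y))\<^sup>2)\<^sup>2 = ((transpose L *v (L *v y)) \<bullet> y)\<^sup>2"
      by (simp add: adj power2_norm_eq_inner)
    also have "\<dots> \<le> (norm (transpose L *v (L *v y)) * norm y)\<^sup>2"
      by (metis Cauchy_Schwarz_ineq2 abs_ge_zero power2_abs power_mono)
    also have "\<dots> \<le> (2 * (norm (L *v y))\<^sup>2) * (norm y)\<^sup>2"
      unfolding power_mult_distrib by (rule mult_right_mono[OF L]) simp
    finally have "(norm (L *v y))\<^sup>2 * (norm (L *v y))\<^sup>2 \<le> (norm (L *v y))\<^sup>2 * (2 * (norm y)\<^sup>2)"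
      by (simp add: power2_eq_square mult_ac)
    then show ?thesis by (rule mult_left_le_imp_le) (use False in simp)
  qed simp
  define Q where "Q = transpose L ** diag_mat (\<chi> i. a i) ** L"
  have "transpose (diag_mat (\<chi> i. a i)) = diag_mat (\<chi> i. a i)"
    by (simp add: diag_mat_def transpose_def vec_eq_iff)
  then have symQ: "transpose Q = Q" by (simp add: Q_def matrix_transpose_mul matrix_mul_assoc)
  have quadQ: "y \<bullet> (Q *v y) = (\<Sum>i\<in>UNIV. a i * (L $ i \<bullet> y)\<^sup>2)" for y
  proof -
    have "y \<bullet> (Q *v y) = (transpose L *v (diag_mat (\<chi> i. a i) *v (L *v y))) \<bullet> y"
      by (simp add: Q_def matrix_vector_mul_assoc[symmetric] inner_commute)
    also have "\<dots> = (diag_mat (\<chi> i. a i) *v (L *v y)) \<bullet> (L *v y)" by (rule adj)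
    finally show ?thesis
      by (simp add: inner_vec_def[of "_ *v _"] diag_mat_mult_vec Lc power2_eq_square mult_ac)
  qed
  obtain e :: "'n \<Rightarrow> real^'n" and l where e: "\<And>i j. e i \<bullet> e j = (if i = j then 1 else 0)"
    and l: "\<And>i. Q *v e i = l i *\<^sub>R e i"
    using symmetric_matrix_orthonormal_eigenbasis[OF symQ] by metis
  have nrm: "(norm (e k))\<^sup>2 = 1" for k by (simp add: power2_norm_eq_inner e)
  have lk: "l k = (\<Sum>i\<in>UNIV. a i * (L $ i \<bullet> e k)\<^sup>2)" for k
    using quadQ[of "e k"] by (simp add: l e)
  have l0: "0 \<le> l k" for k unfolding lk using a(1) by (auto intro!: sum_nonneg)
  have l1: "l k \<le> 2 * d\<^sup>2" for k
  proof -
    have "l k \<le> (\<Sum>i\<in>UNIV. d\<^sup>2 * (L $ i \<bullet> e k)\<^sup>2)"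
      unfolding lk using a(3) by (intro sum_mono mult_right_mono) auto
    also have "\<dots> = d\<^sup>2 * (norm (L *v e k))\<^sup>2" by (simp add: norm_vec_square Lc sum_distrib_left)
    also have "\<dots> \<le> d\<^sup>2 * 2" using Lv[of "e k"] by (intro mult_left_mono) (auto simp: nrm)
    finally show ?thesis by simp
  qed
  have tr: "(\<Sum>k\<in>UNIV. l k) = (\<Sum>i\<in>UNIV. a i * (norm (L $ i))\<^sup>2)"
  proof -
    have "(\<Sum>k\<in>UNIV. l k) = (\<Sum>i\<in>UNIV. a i * (\<Sum>k\<in>UNIV. (e k \<bullet> L $ i) * (e k \<bullet> L $ i)))"
      unfolding lk by (subst sum.swap) (simp add: sum_distrib_left power2_eq_square inner_commute)
    then show ?thesis by (simp add: orthonormal_family_parseval[OF e] power2_norm_eq_inner)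
  qed
  have tr2: "(\<Sum>k\<in>UNIV. l k) \<le> 2"
  proof -
    have "(\<Sum>i\<in>UNIV. a i * (norm (L $ i))\<^sup>2) \<le> (\<Sum>i\<in>UNIV. a i * 2)"
      using a(1) rowL by (intro sum_mono mult_left_mono) auto
    also have "\<dots> = 2" using a(2) by (simp add: sum_distrib_right[symmetric])
    finally show ?thesis by (simp add: tr)
  qed
  have l2: "(\<Sum>k\<in>UNIV. (l k)\<^sup>2) \<le> (2 * d)\<^sup>2"
  proof -
    have "(\<Sum>k\<in>UNIV. (l k)\<^sup>2) \<le> (\<Sum>k\<in>UNIV. 2 * d\<^sup>2 * l k)"
      unfolding power2_eq_square[of "l _"] using l0 l1 by (intro sum_mono mult_right_mono) auto
    also have "\<dots> = 2 * d\<^sup>2 * (\<Sum>k\<in>UNIV. l k)" by (simp add: sum_distrib_left)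
    also have "\<dots> \<le> 2 * d\<^sup>2 * 2" by (rule mult_left_mono[OF tr2]) simp
    finally show ?thesis by (simp add: power_mult_distrib)
  qed
  have diagonal: "(\<Sum>i\<in>UNIV. a i * (L $ i \<bullet> y)\<^sup>2) = (\<Sum>k\<in>UNIV. l k * (e k \<bullet> y)\<^sup>2)" for y
  proof -
    have "e k \<bullet> (Q *v y) = l k * (e k \<bullet> y)" for k
      using symmetric_matrix_inner[OF symQ, of "e k" y] by (simp add: l)
    then show ?thesis
      using orthonormal_family_parseval[OF e, of y "Q *v y"]
      unfolding quadQ[symmetric] by (simp add: power2_eq_square mult_ac)
  qed
  define Z where "Z \<omega> = (\<Sum>k\<in>UNIV. l k * (e k \<bullet> g \<omega>)\<^sup>2) - (\<Sum>k\<in>UNIV. l k)" for \<omega>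
  have Zm [measurable]: "Z \<in> borel_measurable M" unfolding Z_def by measurable
  define E1 where "E1 = {\<omega> \<in> space M. Z \<omega> \<ge> 2 * (2 * d) * sqrt x + 2 * (2 * d\<^sup>2) * x}"
  define E2 where "E2 = {\<omega> \<in> space M. - Z \<omega> \<ge> 2 * (2 * d) * sqrt x}"
  have d2: "2 * d > 0" using d by simp
  have E1: "E1 \<in> sets M" "prob E1 \<le> exp (- x)" and E2: "E2 \<in> sets M" "prob E2 \<le> exp (- x)"
    unfolding E1_def E2_def Z_def
    using std_normal_quadratic_upper_deviation[OF g e l0 l1 l2 d2 x]
      std_normal_quadratic_lower_deviation[OF g e l0 l1 l2 d2 x] by simp_all
  define u where "u = 2 *\<^sub>R (transpose L *v (\<chi> i. a i * b $ i))"
  have uy: "u \<bullet> y = 2 * (\<Sum>i\<in>UNIV. a i * b $ i * (L $ i \<bullet> y))" for y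
    by (simp add: u_def adj) (simp add: inner_vec_def[of _ "L *v y"] Lc)
  define c where "c = sqrt 8 * d\<^sup>2 * norm b"
  have un: "norm u \<le> c"
  proof (rule power2_le_imp_le)
    have "(a i * b $ i)\<^sup>2 \<le> (d\<^sup>2)\<^sup>2 * (b $ i)\<^sup>2" for i
      unfolding power_mult_distrib[of "a i"] using a by (intro mult_right_mono power_mono) auto
    then have ab: "(norm (\<chi> i. a i * b $ i))\<^sup>2 \<le> (d\<^sup>2)\<^sup>2 * (norm b)\<^sup>2"
      unfolding norm_vec_square sum_distrib_left by (intro sum_mono) simp
    have "(norm u)\<^sup>2 \<le> 4 * (2 * (norm (\<chi> i. a i * b $ i))\<^sup>2)"
      using L[of "\<chi> i. a i * b $ i"] by (simp add: u_def power_mult_distrib)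
    also have "\<dots> \<le> 8 * ((d\<^sup>2)\<^sup>2 * (norm b)\<^sup>2)" using ab by linarith
    finally show "(norm u)\<^sup>2 \<le> c\<^sup>2" by (simp add: c_def power_mult_distrib)
  qed (simp add: c_def)
  have cx: "c * sqrt (2 * x) = 4 * sqrt x * d\<^sup>2 * norm b"
  proof -
    have "sqrt 8 * sqrt (2 * x) = 4 * sqrt x"
      by (simp add: real_sqrt_mult[symmetric]) (simp add: real_sqrt_mult)
    then have "(sqrt 8 * sqrt (2 * x)) * (d\<^sup>2 * norm b) = 4 * sqrt x * (d\<^sup>2 * norm b)" by (simp only:)
    then show ?thesis unfolding c_def by (simp only: mult_ac)
  qed
  \<comment> \<open>For \<open>b = 0\<close> both the cross term and its threshold vanish; the events \<open>u \<bullet> g \<ge> 0\<close> would then be certain.\<close>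
  define E3 where "E3 = (if b = 0 then {} else {\<omega> \<in> space M. u \<bullet> g \<omega> \<ge> c * sqrt (2 * x)})"
  define E4 where "E4 = (if b = 0 then {} else {\<omega> \<in> space M. (- u) \<bullet> g \<omega> \<ge> c * sqrt (2 * x)})"
  have c0: "c > 0" if "b \<noteq> 0" using that d by (simp add: c_def)
  have E3: "E3 \<in> sets M" "prob E3 \<le> exp (- x)"
    using std_normal_linear_deviation[OF g un c0 x] by (auto simp: E3_def)
  have E4: "E4 \<in> sets M" "prob E4 \<le> exp (- x)"
    using std_normal_linear_deviation[OF g, of "- u" c x] un c0 x by (auto simp: E4_def)
  define E where "E = (E1 \<union> E2) \<union> (E3 \<union> E4)"
  show ?thesis
  proof (rule that[of E])
    show "E \<in> sets M" using E1 E2 E3 E4 by (simp add: E_def)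
    have "prob E \<le> (prob E1 + prob E2) + (prob E3 + prob E4)"
      unfolding E_def using E1 E2 E3 E4
      by (intro order_trans[OF measure_Un_le] add_mono) (auto intro!: measure_Un_le)
    then show "prob E \<le> 4 * exp (- x)" using E1 E2 E3 E4 by simp
    fix \<omega> assume \<omega>: "\<omega> \<in> space M - E"
    have z: "Z \<omega> \<le> 4 * sqrt x * d + 4 * x * d\<^sup>2" "- Z \<omega> \<le> 4 * sqrt x * d"
      using \<omega> by (auto simp: E_def E1_def E2_def mult_ac)
    have lin: "\<bar>u \<bullet> g \<omega>\<bar> \<le> 4 * sqrt x * d\<^sup>2 * norm b"
    proof (cases "b = 0")
      case True
      then show ?thesis by (simp add: uy)
    next
      case False
      then show ?thesis using \<omega> by (auto simp: E_def E3_def E4_def cx)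
    qed
    have bb: "(b $ i)\<^sup>2 \<le> (infnorm b)\<^sup>2" for i
      using component_le_infnorm_cart[of b i] power_mono[of "\<bar>b $ i\<bar>" "infnorm b" 2] by simp
    have bias: "(\<Sum>i\<in>UNIV. a i * (b $ i)\<^sup>2) \<le> (infnorm b)\<^sup>2" "0 \<le> (\<Sum>i\<in>UNIV. a i * (b $ i)\<^sup>2)"
    proof -
      have "(\<Sum>i\<in>UNIV. a i * (b $ i)\<^sup>2) \<le> (\<Sum>i\<in>UNIV. a i * (infnorm b)\<^sup>2)"
        using a bb by (intro sum_mono mult_left_mono) auto
      then show "(\<Sum>i\<in>UNIV. a i * (b $ i)\<^sup>2) \<le> (infnorm b)\<^sup>2"
        using a(2) by (simp add: sum_distrib_right[symmetric])
    qed (use a in \<open>auto intro!: sum_nonneg\<close>)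
    have var: "\<bar>(\<Sum>k\<in>UNIV. l k) - 1\<bar> \<le> \<delta>"
    proof -
      have "(\<Sum>k\<in>UNIV. l k) - 1 = (\<Sum>i\<in>UNIV. a i * ((norm (L $ i))\<^sup>2 - 1))"
        using a(2) by (simp add: tr right_diff_distrib sum_subtractf)
      also have "\<bar>\<dots>\<bar> \<le> (\<Sum>i\<in>UNIV. a i * \<delta>)"
        using a(1) de by (intro order_trans[OF sum_abs] sum_mono) (simp add: abs_mult mult_left_mono)
      also have "\<dots> = \<delta>" using a(2) by (simp add: sum_distrib_right[symmetric])
      finally show ?thesis .
    qed
    have "(\<Sum>i\<in>UNIV. a i * (b $ i + (L *v g \<omega>) $ i)\<^sup>2)
        = (\<Sum>i\<in>UNIV. a i * (b $ i)\<^sup>2) + u \<bullet> g \<omega> + (\<Sum>i\<in>UNIV. a i * (L $ i \<bullet> g \<omega>)\<^sup>2)"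
      by (simp add: Lc uy power2_sum algebra_simps sum.distrib sum_distrib_left)
    also have "\<dots> = (\<Sum>i\<in>UNIV. a i * (b $ i)\<^sup>2) + u \<bullet> g \<omega> + Z \<omega> + (\<Sum>k\<in>UNIV. l k)"
      by (simp add: diagonal Z_def)
    finally have eq: "(\<Sum>i\<in>UNIV. a i * (b $ i + (L *v g \<omega>) $ i)\<^sup>2)
        = (\<Sum>i\<in>UNIV. a i * (b $ i)\<^sup>2) + u \<bullet> g \<omega> + Z \<omega> + (\<Sum>k\<in>UNIV. l k)" .
    have "0 \<le> 4 * x * d\<^sup>2" using x by simp
    then show "\<bar>(\<Sum>i\<in>UNIV. a i * (b $ i + (L *v g \<omega>) $ i)\<^sup>2) - 1\<bar> \<le> Delta_p x b d \<delta>"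
      unfolding eq Delta_p_def using z lin bias var by linarith
  qed
qed

end

section \<open>The bootstrap variance is close to the true variance\<close>

lemma (in prob_space) expectation_norm_sq_scaled_gaussian:
  fixes g :: "'a \<Rightarrow> real^'n" and K :: "real^'n^'q"
  assumes g: "indep_normal_vector M g 0 (\<chi> i. 1)"
  shows "(\<integral>\<omega>. (norm (K *v (\<chi> i. sd $ i * g \<omega> $ i)))\<^sup>2 \<partial>M)
    = (\<Sum>i\<in>UNIV. (norm (column i K))\<^sup>2 * (sd $ i)\<^sup>2)"
proof -
  note m = std_normal_vector_linear_moments[OF g]
  define k where "k q = (\<chi> i. K $ q $ i * sd $ i)" for q
  have "(norm (K *v (\<chi> i. sd $ i * g \<omega> $ i)))\<^sup>2 = (\<Sum>q\<in>UNIV. (k q \<bullet> g \<omega>) * (k q \<bullet> g \<omega>))" for \<omega>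
    unfolding norm_vec_square
    by (simp add: k_def matrix_vector_mult_def inner_vec_def power2_eq_square mult_ac)
  then have "(\<integral>\<omega>. (norm (K *v (\<chi> i. sd $ i * g \<omega> $ i)))\<^sup>2 \<partial>M) = (\<Sum>q\<in>UNIV. k q \<bullet> k q)"
    by (simp add: m)
  also have "\<dots> = (\<Sum>q\<in>UNIV. \<Sum>i\<in>UNIV. (K $ q $ i)\<^sup>2 * (sd $ i)\<^sup>2)"
    by (simp add: k_def inner_vec_def power2_eq_square mult_ac)
  also have "\<dots> = (\<Sum>i\<in>UNIV. (norm (column i K))\<^sup>2 * (sd $ i)\<^sup>2)"
    unfolding norm_vec_square by (subst sum.swap) (simp add: column_def sum_distrib_right)
  finally show ?thesis .
qed

lemma linear_std_residual:
  assumes "linear P"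
  shows "linear (std_residual sd P)"
proof -
  have "linear (presmooth_residual P)"
    unfolding presmooth_residual_def[abs_def] by (rule linear_compose_sub[OF linear_ident assms])
  from linear_compose[OF this matrix_vector_mul_linear]
  show ?thesis by (simp add: comp_def std_residual_def[abs_def])
qed

lemma (in prob_space) covariance_matrix_linear_image:
  fixes g :: "'a \<Rightarrow> real^'n" and L :: "real^'n^'m"
  assumes g: "indep_normal_vector M g 0 (\<chi> i. 1)"
    and X: "\<And>\<omega>. \<omega> \<in> space M \<Longrightarrow> X \<omega> = L *v g \<omega>"
  shows "covariance_matrix M X = L ** transpose L"
proof -
  note m = std_normal_vector_linear_moments[OF g]
  have Xi: "X \<omega> $ i = L $ i \<bullet> g \<omega>" if "\<omega> \<in> space M" for \<omega> i
    using X[OF that] by (simp add: matrix_vector_mul_component)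
  have mean: "(\<integral>\<omega>. X \<omega> $ i \<partial>M) = 0" for i
    using m(2)[of "L $ i"] by (simp add: Xi cong: Bochner_Integration.integral_cong)
  have "(\<integral>\<omega>. X \<omega> $ i * X \<omega> $ j \<partial>M) = L $ i \<bullet> L $ j" for i j
    using m(4)[of "L $ i" "L $ j"] by (simp add: Xi cong: Bochner_Integration.integral_cong)
  then show ?thesis
    by (simp add: covariance_matrix_def mean matrix_matrix_mult_def transpose_def inner_vec_def vec_eq_iff)
qed

text \<open>The left side is the quadratic form of \<open>L L\<^sup>T\<close> at \<open>v\<close>, which differs from \<open>\<parallel>v\<parallel>\<^sup>2\<close> by at most the operator norm
  of \<open>L L\<^sup>T - I\<close> times \<open>\<parallel>v\<parallel>\<^sup>2\<close>.\<close>

lemma norm_transpose_mult_vec_le: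
  fixes L :: "real^'n^'m"
  assumes "onorm ((*v) (L ** transpose L - mat 1)) \<le> 1"
  shows "(norm (transpose L *v v))\<^sup>2 \<le> 2 * (norm v)\<^sup>2"
proof -
  note [simp del] = transpose_matrix_vector
  let ?D = "L ** transpose L - mat 1"
  have "norm (?D *v v) \<le> onorm ((*v) ?D) * norm v"
    by (rule onorm) (simp add: linear_conv_bounded_linear[symmetric])
  also have "\<dots> \<le> norm v" using mult_right_mono[OF assms, of "norm v"] by simp
  finally have D: "norm (?D *v v) \<le> norm v" .
  have "(norm (transpose L *v v))\<^sup>2 = v \<bullet> (L *v (transpose L *v v))"
    by (metis dot_lmul_matrix transpose_matrix_vector power2_norm_eq_inner)
  also have "L *v (transpose L *v v) = ?D *v v + v"
    by (simp add: matrix_vector_mult_diff_rdistrib matrix_vector_mul_assoc)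
  also have "v \<bullet> (?D *v v + v) \<le> norm v * norm (?D *v v) + (norm v)\<^sup>2"
    by (simp add: inner_add_right power2_norm_eq_inner norm_cauchy_schwarz)
  also have "\<dots> \<le> 2 * (norm v)\<^sup>2"
    using mult_left_mono[OF D, of "norm v"] by (simp add: power2_eq_square)
  finally show ?thesis .
qed

lemma card_increasing_pairs_le:
  fixes A :: "'b :: linorder set"
  assumes "finite A"
  shows "2 * card {(m, m'). m \<in> A \<and> m' \<in> A \<and> m < m'} \<le> (card A)\<^sup>2"
proof -
  let ?P = "{(m, m'). m \<in> A \<and> m' \<in> A \<and> m < m'}"
  have fin: "finite ?P" by (rule finite_subset[of _ "A \<times> A"]) (use assms in auto)
  have "card (?P \<union> ?P\<inverse>) = card ?P + card ?P"
    using fin by (subst card_Un_disjoint) (auto simp: card_inverse)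
  moreover have "card (?P \<union> ?P\<inverse>) \<le> card (A \<times> A)"
    using assms by (intro card_mono) auto
  ultimately show ?thesis by (simp add: card_cartesian_product power2_eq_square)
qed

theorem theorem3p3:
  fixes M :: "'a measure"
    and Y eps w :: "'a \<Rightarrow> real^'n"
    and f sd :: "real^'n"
    and Psi :: "real^'n^'p"
    and P :: "real^'n \<Rightarrow> real^'n"
    and W :: "real^'p^'q"
    and models :: "real set"
    and features :: "real \<Rightarrow> 'p set"
    and x :: real
  assumes "prob_space M"
    and "\<And>i. sd $ i > 0"
    and "\<And>\<omega>. \<omega> \<in> space M \<Longrightarrow> Y \<omega> = f + eps \<omega>"
    and "indep_normal_vector M Y f sd"
    and "indep_normal_vector M w 0 (\<chi> i. 1)"
    and "prob_space.indep_var M borel Y borel w"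
    and "invertible (design_matrix sd Psi)"
    and "finite models"
    and "\<And>m. m \<in> models \<Longrightarrow> m > 0"
    and "\<And>m m'. m \<in> models \<Longrightarrow> m' \<in> models \<Longrightarrow> m < m' \<Longrightarrow>
           p_var M W Psi (features m) (features m') eps > 0"
    and "linear P"
    and "onorm ((*v) (covariance_matrix M (\<lambda>\<omega>. std_residual sd P (eps \<omega>)) - mat 1)) \<le> 1"
    and "x > 0"
  shows "\<exists>Om \<in> sets M. measure M Om \<ge> 1 - 3 * exp (- x) \<and>
           (\<forall>\<omega>\<in>Om. \<forall>m\<in>models. \<forall>m'\<in>models. m < m' \<longrightarrow>
              \<bar>p_boot M W Psi (features m) (features m') P Y w \<omega> /
                 p_var M W Psi (features m) (features m') eps - 1\<bar>
              \<le> Delta_p (x + 2 * ln (real (card models)))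
                  (std_residual sd P f) (delta_Psi sd Psi) (delta_eps M sd P eps))"
proof -
  interpret prob_space M by fact
  note sd = assms(2) and lin = assms(11) and x = assms(13)
  define g where "g \<omega> = (\<chi> i. (Y \<omega> $ i - f $ i) / sd $ i)" for \<omega>
  have g: "indep_normal_vector M g 0 (\<chi> i. 1)"
    unfolding g_def by (rule indep_normal_vector_standardize[OF assms(4) sd])
  \<comment> \<open>Standardized residuals of the noise as a linear image of the standard normal \<open>g\<close>.\<close>
  define L where "L = matrix (\<lambda>v. std_residual sd P (\<chi> i. sd $ i * v $ i))"
  note lsr = linear_std_residual[OF lin, of sd]
  have "linear (\<lambda>v :: real^'n. \<chi> i. sd $ i * v $ i)"
    by (rule linearI) (simp_all add: vec_eq_iff algebra_simps)
  from linear_compose[OF this lsr]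
  have "linear (\<lambda>v. std_residual sd P (\<chi> i. sd $ i * v $ i))" by (simp add: comp_def)
  then have L: "L *v v = std_residual sd P (\<chi> i. sd $ i * v $ i)" for v
    unfolding L_def by (rule fun_cong[OF matrix_vector_mul(2)])
  have Yg: "Y \<omega> = f + (\<chi> i. sd $ i * g \<omega> $ i)" for \<omega>
    using sd by (simp add: g_def vec_eq_iff less_imp_neq[symmetric])
  have eps: "eps \<omega> = (\<chi> i. sd $ i * g \<omega> $ i)" if "\<omega> \<in> space M" for \<omega>
    using assms(3)[OF that] Yg[of \<omega>] by simp
  define b where "b = std_residual sd P f"
  have srY: "std_residual sd P (Y \<omega>) = b + L *v g \<omega>" for \<omega>
    unfolding Yg b_def L by (rule linear_add[OF lsr])
  have srE: "std_residual sd P (eps \<omega>) = L *v g \<omega>" if "\<omega> \<in> space M" for \<omega>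
    using eps[OF that] L by simp
  note Lc = matrix_vector_mul_component[of L]
  note m = std_normal_vector_linear_moments[OF g]

  have Lop: "(norm (transpose L *v v))\<^sup>2 \<le> 2 * (norm v)\<^sup>2" for v
    using assms(12) covariance_matrix_linear_image[OF g srE] norm_transpose_mult_vec_le by simp
  have de: "\<bar>(norm (L $ i))\<^sup>2 - 1\<bar> \<le> delta_eps M sd P eps" for i
  proof -
    have "(\<integral>\<omega>. (std_residual sd P (eps \<omega>) $ i)\<^sup>2 \<partial>M) = (\<integral>\<omega>. (L $ i \<bullet> g \<omega>) * (L $ i \<bullet> g \<omega>) \<partial>M)"
      by (rule Bochner_Integration.integral_cong) (simp_all add: srE Lc power2_eq_square)
    then have "(\<integral>\<omega>. (std_residual sd P (eps \<omega>) $ i)\<^sup>2 \<partial>M) = (norm (L $ i))\<^sup>2"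
      by (simp add: m power2_norm_eq_inner)
    then show ?thesis unfolding delta_eps_def
      by (metis (mono_tags, lifting) Max_ge finite finite_imageI rangeI)
  qed

  define h where "h = presmooth_residual P"
  have h: "h y $ i = sd $ i * std_residual sd P y $ i" for y i
    using sd[of i] by (simp add: h_def presmooth_residual_def std_residual_component[OF sd])
  have hm: "h \<in> borel_measurable borel"
    unfolding h_def presmooth_residual_def[abs_def]
    by (intro borel_measurable_continuous_onI continuous_intros linear_continuous_on
        linear_conv_bounded_linear[THEN iffD1] lin)
  have hint: "integrable M (\<lambda>\<omega>. h (Y \<omega>) $ i * h (Y \<omega>) $ j)" for i j
  proof -
    have *: "h (Y \<omega>) $ i * h (Y \<omega>) $ j = (sd $ i * sd $ j) * (b $ i * b $ j + b $ i * (L $ j \<bullet> g \<omega>)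
        + b $ j * (L $ i \<bullet> g \<omega>) + (L $ i \<bullet> g \<omega>) * (L $ j \<bullet> g \<omega>))" for \<omega>
      by (simp add: h srY Lc algebra_simps)
    show ?thesis
      unfolding * by (intro integrable_mult_right Bochner_Integration.integrable_add m) simp
  qed

  define K where "K m m' = contrast_op W Psi (features m) (features m')" for m m'
  define p where "p m m' = p_var M W Psi (features m) (features m') eps" for m m'
  define pb where "pb m m' = p_boot M W Psi (features m) (features m') P Y w" for m m'
  define a where "a m m' i = (norm (column i (K m m')))\<^sup>2 * (sd $ i)\<^sup>2 / p m m'" for m m' i
  define d where "d = delta_Psi sd Psi"
  define xM where "xM = x + 2 * ln (real (card models))"
  define Pr where "Pr = {(m, m'). m \<in> models \<and> m' \<in> models \<and> m < m'}"
  have finPr: "finite Pr"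
    unfolding Pr_def by (rule finite_subset[of _ "models \<times> models"]) (use assms(8) in auto)
  have p: "p m m' = (\<Sum>i\<in>UNIV. (norm (column i (K m m')))\<^sup>2 * (sd $ i)\<^sup>2)" for m m'
  proof -
    have "p m m' = (\<integral>\<omega>. (norm (K m m' *v (\<chi> i. sd $ i * g \<omega> $ i)))\<^sup>2 \<partial>M)"
      unfolding p_def p_var_def xi_def K_def
      by (rule Bochner_Integration.integral_cong) (simp_all add: eps)
    then show ?thesis by (simp add: expectation_norm_sq_scaled_gaussian[OF g])
  qed
  \<comment> \<open>The conditional expectation is determined only almost everywhere; the exceptional null set is removed at the end.\<close>
  have pb: "AE \<omega> in M. pb m m' \<omega> = (\<Sum>i\<in>UNIV. (norm (column i (K m m')))\<^sup>2 * (h (Y \<omega>) $ i)\<^sup>2)" for m m'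
    unfolding pb_def p_boot_def xi_boot_def K_def h_def[symmetric]
    by (rule cond_exp_given_weighted_gaussian[OF assms(5,6) hm hint])

  define exceptional where "exceptional m m' E \<longleftrightarrow> E \<in> sets M \<and> prob E \<le> 4 * exp (- xM) \<and>
    (\<forall>\<omega>\<in>space M - E. \<bar>(\<Sum>i\<in>UNIV. a m m' i * (b $ i + (L *v g \<omega>) $ i)\<^sup>2) - 1\<bar>
      \<le> Delta_p xM b d (delta_eps M sd P eps))" for m m' E
  have "\<exists>E. exceptional m m' E"
    if "(m, m') \<in> Pr" for m m'
  proof -
    have mm: "m \<in> models" "m' \<in> models" "m < m'" using that by (auto simp: Pr_def)
    then have pp: "p m m' > 0" unfolding p_def by (intro assms(10))
    have a0: "0 \<le> a m m' i" for i using pp by (simp add: a_def)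
    have a1: "(\<Sum>i\<in>UNIV. a m m' i) = 1"
      using pp by (simp add: a_def sum_divide_distrib[symmetric] p[symmetric])
    have ad: "a m m' i \<le> d\<^sup>2" for i
    proof -
      obtain A where "K m m' = A ** Psi" unfolding K_def using contrast_op_factors_through_Psi by blast
      then have "(norm (column i (K m m')))\<^sup>2 * (sd $ i)\<^sup>2 \<le> d\<^sup>2 * p m m'"
        unfolding p d_def using leverage_le_delta_Psi[OF assms(7) sd] by simp
      then show ?thesis using pp by (simp add: a_def pos_divide_le_eq)
    qed
    have "d \<ge> 0"
    proof -
      fix i
      have "norm (inv_sqrt (design_matrix sd Psi) *v column i Psi) * sd $ i \<le> d"
        unfolding d_def delta_Psi_def by (rule Max_ge) auto
      then show ?thesis using sd[of i] by (meson less_imp_le mult_nonneg_nonneg norm_ge_zero order_trans)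
    qed
    moreover have "d \<noteq> 0"
    proof
      assume "d = 0"
      then have "a m m' i = 0" for i using a0[of i] ad[of i] by simp
      then show False using a1 by simp
    qed
    ultimately have d: "d > 0" by simp
    have "card models > 0" using mm assms(8) by (auto simp: card_gt_0_iff)
    then have "xM > 0" using x by (simp add: xM_def add_pos_nonneg)
    then show ?thesis
      unfolding exceptional_def
      by (rule weighted_square_residual_deviation[OF g a0 a1 ad d Lop de, of xM b]) blast
  qed
  then have "\<forall>q\<in>Pr. \<exists>E. exceptional (fst q) (snd q) E" by auto
  then obtain E where E: "\<And>q. q \<in> Pr \<Longrightarrow> exceptional (fst q) (snd q) (E q)"
    using bchoice[of Pr "\<lambda>q. exceptional (fst q) (snd q)"] by blast
  have "AE \<omega> in M. \<forall>q\<in>Pr. pb (fst q) (snd q) \<omega>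
      = (\<Sum>i\<in>UNIV. (norm (column i (K (fst q) (snd q))))\<^sup>2 * (h (Y \<omega>) $ i)\<^sup>2)"
    using finPr pb by (intro AE_finite_allI) auto
  then obtain N where N: "N \<in> null_sets M" "\<And>\<omega> q. \<omega> \<in> space M - N \<Longrightarrow> q \<in> Pr \<Longrightarrow>
      pb (fst q) (snd q) \<omega> = (\<Sum>i\<in>UNIV. (norm (column i (K (fst q) (snd q))))\<^sup>2 * (h (Y \<omega>) $ i)\<^sup>2)"
    by (elim AE_E3) blast
  define Bad where "Bad = (\<Union>q\<in>Pr. E q)"
  have Em: "E q \<in> sets M" if "q \<in> Pr" for q using E[OF that] by (simp add: exceptional_def)
  have Bm: "Bad \<in> sets M" unfolding Bad_def using finPr Em by blast
  \<comment> \<open>At most \<open>n\<^sup>2 / 2\<close> pairs, each of probability at most \<open>4 exp (- xM) = 4 exp (- x) / n\<^sup>2\<close> where \<open>n = card models\<close>.\<close>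
  have "prob Bad \<le> (\<Sum>q\<in>Pr. prob (E q))"
    unfolding Bad_def using finPr Em by (intro finite_measure_subadditive_finite) auto
  also have "\<dots> \<le> (\<Sum>q\<in>Pr. 4 * exp (- xM))"
    using E by (intro sum_mono) (simp add: exceptional_def)
  also have "\<dots> = 2 * (2 * real (card Pr)) * exp (- xM)" by simp
  also have "\<dots> \<le> 2 * exp (- x)"
  proof (cases "models = {}")
    case True
    then show ?thesis by (simp add: Pr_def)
  next
    case False
    then have n: "real (card models) > 0" using assms(8) by (simp add: card_gt_0_iff)
    have "exp (- xM) = exp (- x) / (real (card models))\<^sup>2"
      using n by (simp add: xM_def exp_diff power2_eq_square exp_double)
    then have ex: "(real (card models))\<^sup>2 * exp (- xM) = exp (- x)" using n by simp
    have "real (2 * card Pr) \<le> real ((card models)\<^sup>2)"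
      using card_increasing_pairs_le[OF assms(8)] unfolding Pr_def of_nat_le_iff .
    then have "2 * real (card Pr) \<le> (real (card models))\<^sup>2" by simp
    from mult_right_mono[OF this, of "exp (- xM)"] show ?thesis by (simp add: ex)
  qed
  finally have PB: "prob Bad \<le> 2 * exp (- x)" .
  define Om where "Om = space M - (Bad \<union> N)"
  have Nm: "N \<in> sets M" "prob N = 0" using N(1) by (auto simp: null_sets_def measure_def)
  show ?thesis
  proof (intro bexI[of _ Om] conjI ballI impI)
    show "Om \<in> sets M" unfolding Om_def using Bm Nm by auto
    have "prob (Bad \<union> N) \<le> 2 * exp (- x)"
      using measure_Un_le[OF Bm Nm(1)] PB Nm(2) by simp
    moreover have "prob Om = 1 - prob (Bad \<union> N)"
      unfolding Om_def using Bm Nm by (intro prob_compl) auto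
    ultimately show "measure M Om \<ge> 1 - 3 * exp (- x)" using exp_gt_zero[of "-x"] by linarith
    fix \<omega> m m'
    assume \<omega>: "\<omega> \<in> Om" and mm: "m \<in> models" "m' \<in> models" "m < m'"
    then have q: "(m, m') \<in> Pr" by (simp add: Pr_def)
    have pp: "p m m' > 0" unfolding p_def using mm by (intro assms(10))
    have "pb m m' \<omega> = (\<Sum>i\<in>UNIV. (norm (column i (K m m')))\<^sup>2 * (h (Y \<omega>) $ i)\<^sup>2)"
      using N(2)[of \<omega> "(m, m')"] q \<omega> by (simp add: Om_def)
    then have "pb m m' \<omega> / p m m' = (\<Sum>i\<in>UNIV. a m m' i * (b $ i + (L *v g \<omega>) $ i)\<^sup>2)"
      by (simp add: a_def h srY power_mult_distrib sum_divide_distrib mult_ac)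
    moreover have "\<omega> \<in> space M - E (m, m')" using \<omega> q by (auto simp: Om_def Bad_def)
    ultimately have "\<bar>pb m m' \<omega> / p m m' - 1\<bar> \<le> Delta_p xM b d (delta_eps M sd P eps)"
      using E[OF q] by (simp add: exceptional_def)
    then show "\<bar>p_boot M W Psi (features m) (features m') P Y w \<omega> /
                 p_var M W Psi (features m) (features m') eps - 1\<bar>
              \<le> Delta_p (x + 2 * ln (real (card models)))
                  (std_residual sd P f) (delta_Psi sd Psi) (delta_eps M sd P eps)"
      unfolding pb_def p_def xM_def b_def d_def .
  qed
qed

end
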